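(* Let $n\ge3$. Suppose that smooth functions $f_{2n-1}=f_{2n-1}(x,p_0,\dots,p_{2n-1})$, $L_n=L_n(x,p_0,\dots,p_n)$ and a positive smooth function $\rho_n=\rho_n(x,p_0,\dots,p_n)$ satisfy $$\rho_n\,(p_{2n}-f_{2n-1})=E_{2n}^nL_n\qquad(\ast)$$ for all $(x,p_0,\dots,p_{2n})$. Then there are smooth functions $R_n=R_n(x,p_0,\dots,p_n)$, $f_k=f_k(x,p_0,\dots,p_k)$ $(0\le k\le n-1)$ and $N_{n-1}=N_{n-1}(x,p_0,\dots,p_{n-1})$ such that $$\left\{\begin{array}{rcl} f_{2n-1}&=&\displaystyle nD_{n+1}R_n\cdot p_{2n-1}-e^{R_n}\left[(-1)^nE_{2n-2}^n\int^{p_n}\!\!\!\int e^{-R_n}+\sum_{\ell=1}^{n-1}\left(f_\ell\, p_{2\ell}+(-1)^\ell E_{2\ell-1}^{\ell}\int^{p_\ell}\!\!\!\int f_\ell\right)+f_0\right],\\ \rho_n&=&e^{-R_n},\\ L_n&=&\displaystyle(-1)^n\int^{p_n}\!\!\!\int e^{-R_n}+\sum_{\ell=1}^{n-1}(-1)^\ell\int^{p_\ell}\!\!\!\int f_\ell+\int^{p_0}f_0+D_nN_{n-1}. \end{array}\right.$$ Conversely, given any smooth functions $R_n$, $(f_k)_{0\le k\le n-1}$ and $N_{n-1}$ of the indicated variables, the functions $f_{2n-1}$, $L_n$ and $\rho_n$ defined by these formulas satisfy $(\ast)$.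
   Context: The variables $x,p_0,p_1,p_2,\dots$ are independent real variables and all functions are smooth. The subscript of a function denotes the highest $p$-variable it may depend on: $F_k=F_k(x,p_0,\dots,p_k)$. Write $\partial_k=\partial/\partial p_k$ and $\partial_x=\partial/\partial x$. Truncated total differential operators: $D_0:=\partial_x$ and $D_m:=\partial_x+p_1\partial_0+p_2\partial_1+\cdots+p_m\partial_{m-1}$ for $m\ge1$. Euler--Lagrange operators: $E_m^n:=\sum_{k=0}^n(-1)^kD_m^k\partial_k$ for $m,n\ge0$, where in $D_m^k$ the superscript is a power (composition), while in $E_m^n$ it is only an index. Antiderivatives: for smooth $F$, $$\int^{p_k}F:=\int_0^{p_k}F(x,p_0,\dots,p_{k-1},\tilde p_k,p_{k+1},\dots)\,d\tilde p_k,\qquad \int^{p_k}\!\!\!\int F:=\int_0^{p_k}\!\!\int_0^{\tilde p_k}F(x,p_0,\dots,p_{k-1},\hat p_k,p_{k+1},\dots)\,d\hat p_k\,d\tilde p_k.$$ *)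

theory Defs
  imports "HOL-Analysis.Analysis"
begin

text \<open>
  A function of the independent variables \<open>x, p\<^sub>0, p\<^sub>1, \<dots>\<close> is represented by
  \<open>F :: real \<Rightarrow> (nat \<Rightarrow> real) \<Rightarrow> real\<close>, where \<open>F x p\<close> is its value at
  \<open>x\<close> and \<open>p\<^sub>i = p i\<close>. That \<open>F\<close> is a function of \<open>x, p\<^sub>0, \<dots>, p\<^sub>k\<close> only is the
  predicate \<open>depends_upto k F\<close>.
\<close>

type_synonym jetfun = "real \<Rightarrow> (nat \<Rightarrow> real) \<Rightarrow> real"

definition depends_upto :: "nat \<Rightarrow> jetfun \<Rightarrow> bool" where
  "depends_upto k F \<longleftrightarrow> (\<forall>x p q. (\<forall>i\<le>k. p i = q i) \<longrightarrow> F x p = F x q)"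

definition dx :: "jetfun \<Rightarrow> jetfun" where
  "dx F = (\<lambda>x p. deriv (\<lambda>t. F t p) x)"

definition dp :: "nat \<Rightarrow> jetfun \<Rightarrow> jetfun" where
  "dp k F = (\<lambda>x p. deriv (\<lambda>t. F x (p(k := t))) (p k))"

text \<open>
  \<open>C\<^sup>r\<close> in the classical sense: all partial derivatives up to order \<open>r\<close> exist everywhere and
  are continuous. Continuity refers to the product topology on \<^typ>\<open>real \<times> (nat \<Rightarrow> real)\<close>; for
  a function of finitely many of the variables this is ordinary joint continuity in
  these variables.
\<close>

primrec Cr :: "nat \<Rightarrow> jetfun \<Rightarrow> bool" where
  "Cr 0 F \<longleftrightarrow> continuous_on UNIV (\<lambda>(x, p). F x p)"
| "Cr (Suc r) F \<longleftrightarrow>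
     continuous_on UNIV (\<lambda>(x, p). F x p) \<and>
     (\<forall>x p. (\<lambda>t. F t p) differentiable (at x)) \<and>
     (\<forall>k x p. (\<lambda>t. F x (p(k := t))) differentiable (at (p k))) \<and>
     Cr r (dx F) \<and> (\<forall>k. Cr r (dp k F))"

text \<open>The smooth functions \<open>F\<^sub>k = F\<^sub>k(x, p\<^sub>0, \<dots>, p\<^sub>k)\<close>.\<close>

definition smooth_upto :: "nat \<Rightarrow> jetfun \<Rightarrow> bool" where
  "smooth_upto k F \<longleftrightarrow> depends_upto k F \<and> (\<forall>r. Cr r F)"

text \<open>\<open>D\<^sub>m = \<partial>\<^sub>x + p\<^sub>1 \<partial>\<^sub>0 + \<dots> + p\<^sub>m \<partial>\<^sub>m\<^sub>-\<^sub>1\<close>; for \<open>m = 0\<close> the sum is empty and \<open>D\<^sub>0 = \<partial>\<^sub>x\<close>.\<close>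

definition Dtot :: "nat \<Rightarrow> jetfun \<Rightarrow> jetfun" where
  "Dtot m F = (\<lambda>x p. dx F x p + (\<Sum>i<m. p (Suc i) * dp i F x p))"

text \<open>\<open>Eul m n\<close> is \<open>E\<^sub>m\<^sup>n\<close>: the lower index \<open>m\<close> is the truncation of the total derivative.\<close>

definition Eul :: "nat \<Rightarrow> nat \<Rightarrow> jetfun \<Rightarrow> jetfun" where
  "Eul m n F = (\<lambda>x p. \<Sum>k=0..n. (-1) ^ k * (Dtot m ^^ k) (dp k F) x p)"

text \<open>
  The integrals are oriented: the upper limit \<open>p k\<close> may be negative, and then
  \<open>LBINT t=0..p k\<close> is minus the integral over the interval from \<open>p k\<close> to \<open>0\<close>.
\<close>

definition antider :: "nat \<Rightarrow> jetfun \<Rightarrow> jetfun" where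
  "antider k F = (\<lambda>x p. LBINT t=0..ereal (p k). F x (p(k := t)))"

definition antider2 :: "nat \<Rightarrow> jetfun \<Rightarrow> jetfun" where
  "antider2 k F =
     (\<lambda>x p. LBINT t=0..ereal (p k). (LBINT s=0..ereal t. F x (p(k := s))))"

definition exp_neg :: "jetfun \<Rightarrow> jetfun" where
  "exp_neg R = (\<lambda>x p. exp (- R x p))"

text \<open>
  The right-hand sides of the formulas for \<open>f\<^sub>2\<^sub>n\<^sub>-\<^sub>1\<close> and \<open>L\<^sub>n\<close> in terms of \<open>R = R\<^sub>n\<close>,
  \<open>f k = f\<^sub>k\<close> for \<open>k < n\<close> (the values of \<open>f\<close> at \<open>k \<ge> n\<close> are not used), and \<open>N = N\<^sub>n\<^sub>-\<^sub>1\<close>.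
\<close>

definition f_formula :: "nat \<Rightarrow> jetfun \<Rightarrow> (nat \<Rightarrow> jetfun) \<Rightarrow> jetfun" where
  "f_formula n R f = (\<lambda>x p.
     real n * Dtot (n + 1) R x p * p (2 * n - 1)
     - exp (R x p) *
         ((-1) ^ n * Eul (2 * n - 2) n (antider2 n (exp_neg R)) x p
          + (\<Sum>l = 1..n - 1. f l x p * p (2 * l)
                + (-1) ^ l * Eul (2 * l - 1) l (antider2 l (f l)) x p)
          + f 0 x p))"

definition L_formula :: "nat \<Rightarrow> jetfun \<Rightarrow> (nat \<Rightarrow> jetfun) \<Rightarrow> jetfun \<Rightarrow> jetfun" where
  "L_formula n R f N = (\<lambda>x p.
     (-1) ^ n * antider2 n (exp_neg R) x p
     + (\<Sum>l = 1..n - 1. (-1) ^ l * antider2 l (f l) x p)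
     + antider 0 (f 0) x p
     + Dtot n N x p)"

text \<open>
  \<open>f = f\<^sub>2\<^sub>n\<^sub>-\<^sub>1\<close>, \<open>L = L\<^sub>n\<close> and \<open>\<rho> = \<rho>\<^sub>n > 0\<close> are smooth functions of the indicated variables, and
  \<open>\<rho>\<^sub>n (p\<^sub>2\<^sub>n - f\<^sub>2\<^sub>n\<^sub>-\<^sub>1) = E\<^sub>2\<^sub>n\<^sup>n L\<^sub>n\<close> holds identically.
\<close>

definition multiplier_solution :: "nat \<Rightarrow> jetfun \<Rightarrow> jetfun \<Rightarrow> jetfun \<Rightarrow> bool" where
  "multiplier_solution n f L \<rho> \<longleftrightarrow>
     smooth_upto (2 * n - 1) f \<and> smooth_upto n L \<and> smooth_upto n \<rho> \<and>
     (\<forall>x p. \<rho> x p > 0) \<and>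
     (\<forall>x p. \<rho> x p * (p (2 * n) - f x p) = Eul (2 * n) n L x p)"

end

theory Submission
  imports Defs
begin

text \<open>
  The Euler expression of a Lagrangian \<open>G\<close> of order \<open>l\<close> is affine in its highest variable \<open>p\<^sub>2\<^sub>l\<close>, with slope
  \<open>(-1)\<^sup>l \<partial>\<^sub>l \<partial>\<^sub>l G\<close> (\<open>Eul_leading_term\<close>). Hence the multiplier equation determines
  \<open>\<rho> = (-1)\<^sup>n \<partial>\<^sub>n \<partial>\<^sub>n L\<close>, and \<open>R = - ln \<rho>\<close>.

  Every Lagrangian is, order by order, a sum of double integrals of its second derivatives plus a total
  derivative (\<open>Lagrangian_decomposition\<close>): if the double integral of \<open>\<partial>\<^sub>l \<partial>\<^sub>l L\<close> is
  subtracted, the rest is affine in \<open>p\<^sub>l\<close>, and a suitable total derivative removes the linear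
  term, so that the order drops. This gives the formula for \<open>L\<close>, and the double integral of order \<open>n\<close> is the one
  of \<open>e\<^sup>-\<^sup>R\<close>.

  The formula for \<open>f\<^sub>2\<^sub>n\<^sub>-\<^sub>1\<close> is then the computation of the Euler expression of such an \<open>L\<close>, which also
  proves the converse (\<open>Eul_L_formula\<close>). Total derivatives contribute nothing (\<open>Eul_Dtot\<close>), a summand of order \<open>l < n\<close>
  contributes \<open>f\<^sub>l p\<^sub>2\<^sub>l\<close> and terms of lower order, and for the summand of order \<open>n\<close> the terms with \<open>p\<^sub>2\<^sub>n\<close> and
  \<open>p\<^sub>2\<^sub>n\<^sub>-\<^sub>1\<close> are both extracted (\<open>Eul_two_leading_terms\<close>). All of this rests on the commutator of \<open>\<partial>\<^sub>k\<close> with the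
  total derivative (\<open>dp_Dtot\<close>), hence on the symmetry of mixed partial derivatives, and on
  differentiation under the integral sign for the antiderivatives.
\<close>

section \<open>Partial derivatives and differentiability classes\<close>

text \<open>
  The derivative in \<open>dp\<close> is taken at the current value of the coordinate; integration along a
  coordinate line needs it at every point of the line.
\<close>

lemma has_dp_along_line:
  assumes "\<And>x p. ((\<lambda>t. F x (p(k := t))) has_real_derivative F' x p) (at (p k))"
  shows "((\<lambda>t. F x (p(k := t))) has_real_derivative F' x (p(k := u))) (at u)"
  using assms[of x "p(k := u)"] by simp

lemma dx_eqI: "(\<And>x p. ((\<lambda>t. F t p) has_real_derivative F' x p) (at x)) \<Longrightarrow> dx F = F'"
  by (auto simp: dx_def fun_eq_iff intro!: DERIV_imp_deriv)

lemma dp_eqI: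
  "(\<And>x p. ((\<lambda>t. F x (p(k := t))) has_real_derivative F' x p) (at (p k))) \<Longrightarrow> dp k F = F'"
  by (auto simp: dp_def fun_eq_iff intro!: DERIV_imp_deriv)

lemma Cr_SucD:
  assumes "Cr (Suc r) F"
  shows "((\<lambda>t. F t p) has_real_derivative dx F x p) (at x)"
    and "((\<lambda>t. F x (p(k := t))) has_real_derivative dp k F x p) (at (p k))"
    and "Cr r (dx F)" and "Cr r (dp k F)"
  using assms by (auto simp: dx_def dp_def DERIV_deriv_iff_real_differentiable)

text \<open>
  The form in which closure properties are proved: candidates for the partial derivatives are
  exhibited, so that the induction over \<open>r\<close> applies to them.
\<close>

lemma Cr_SucI:
  assumes "Cr 0 F"
    and "\<And>x p. ((\<lambda>t. F t p) has_real_derivative A x p) (at x)"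
    and "\<And>k x p. ((\<lambda>t. F x (p(k := t))) has_real_derivative B k x p) (at (p k))"
    and "Cr r A" "\<And>k. Cr r (B k)"
  shows "Cr (Suc r) F"
proof -
  have "dx F = A" "\<And>k. dp k F = B k"
    using assms(2,3) by (blast intro: dx_eqI dp_eqI)+
  moreover have "(\<lambda>t. F t p) differentiable (at x)"
    and "(\<lambda>t. F x (p(k := t))) differentiable (at (p k))" for k x p
    unfolding real_differentiable_def using assms(2,3) by blast+
  ultimately show ?thesis
    using assms(1,4,5) by simp
qed

lemma Cr_Suc_imp: "Cr (Suc r) F \<Longrightarrow> Cr r F"
proof (induction r arbitrary: F)
  case (Suc r)
  have "Cr r (dx F)" "Cr r (dp k F)" for k
    using Suc.prems by (simp_all only: Cr.simps(2)[of "Suc r"] Suc.IH)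
  with Suc.prems show ?case
    by (simp only: Cr.simps(2)) blast
qed simp

lemma Cr_le: "Cr r F \<Longrightarrow> s \<le> r \<Longrightarrow> Cr s F"
  by (induction r) (auto simp del: Cr.simps simp: le_Suc_eq dest: Cr_Suc_imp)

lemma Cr_imp_Cr_0: "Cr r F \<Longrightarrow> Cr 0 F"
  by (rule Cr_le) auto

lemma Cr_const: "Cr r (\<lambda>x p. c)"
proof (induction r arbitrary: c)
  case (Suc r)
  show ?case
    by (rule Cr_SucI[where A = "\<lambda>x p. 0" and B = "\<lambda>k x p. 0"])
      (auto intro!: derivative_eq_intros Suc)
qed auto

lemma Cr_coord: "Cr r (\<lambda>x p. p j)"
proof -
  have cont: "Cr 0 (\<lambda>x p. p j)"
    by (auto simp: split_def intro: continuous_on_product_then_coordinatewise[OF continuous_on_snd] continuous_intros)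
  show ?thesis
  proof (cases r)
    case (Suc s)
    show ?thesis unfolding Suc
      by (rule Cr_SucI[where A = "\<lambda>x p. 0" and B = "\<lambda>k x p. if k = j then 1 else 0"])
        (use cont in \<open>auto intro!: derivative_eq_intros Cr_const simp del: Cr.simps\<close>)
  qed (use cont in simp)
qed

lemma Cr_add: "Cr r F \<Longrightarrow> Cr r G \<Longrightarrow> Cr r (\<lambda>x p. F x p + G x p)"
proof (induction r arbitrary: F G)
  case 0
  then show ?case by (auto simp: split_def intro!: continuous_intros)
next
  case (Suc r)
  note F = Cr_SucD[OF Suc.prems(1)] and G = Cr_SucD[OF Suc.prems(2)]
  have "Cr 0 (\<lambda>x p. F x p + G x p)"
    using Suc.prems[THEN Cr_imp_Cr_0] by (auto simp: split_def intro!: continuous_intros)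
  then show ?case
  proof (rule Cr_SucI)
    show "((\<lambda>t. F t p + G t p) has_real_derivative dx F x p + dx G x p) (at x)" for x p
      by (rule DERIV_add F G)+
    show "((\<lambda>t. F x (p(k := t)) + G x (p(k := t))) has_real_derivative
        dp k F x p + dp k G x p) (at (p k))" for k x p
      by (rule DERIV_add F G)+
  qed (intro Suc.IH F G)+
qed

lemma Cr_mult: "Cr r F \<Longrightarrow> Cr r G \<Longrightarrow> Cr r (\<lambda>x p. F x p * G x p)"
proof (induction r arbitrary: F G)
  case 0
  then show ?case by (auto simp: split_def intro!: continuous_intros)
next
  case (Suc r)
  note F = Cr_SucD[OF Suc.prems(1)] and G = Cr_SucD[OF Suc.prems(2)]
  have "Cr 0 (\<lambda>x p. F x p * G x p)"
    using Suc.prems[THEN Cr_imp_Cr_0] by (auto simp: split_def intro!: continuous_intros)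
  then show ?case
  proof (rule Cr_SucI)
    show "((\<lambda>t. F t p * G t p) has_real_derivative dx F x p * G x p + dx G x p * F x p) (at x)" for x p
      by (rule DERIV_mult F G)+
    show "((\<lambda>t. F x (p(k := t)) * G x (p(k := t))) has_real_derivative
        dp k F x p * G x p + dp k G x p * F x p) (at (p k))" for k x p
      by (rule DERIV_cong, rule DERIV_mult, rule F, rule G) simp
  qed (intro Cr_add Suc.IH F G Suc.prems[THEN Cr_Suc_imp])+
qed

lemma Cr_exp: "Cr r F \<Longrightarrow> Cr r (\<lambda>x p. exp (F x p))"
proof (induction r arbitrary: F)
  case 0
  then show ?case by (auto simp: split_def intro!: continuous_intros)
next
  case (Suc r)
  note F = Cr_SucD[OF Suc.prems(1)]
  have "Cr 0 (\<lambda>x p. exp (F x p))"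
    using Suc.prems[THEN Cr_imp_Cr_0] by (auto simp: split_def intro!: continuous_intros)
  then show ?case
  proof (rule Cr_SucI)
    show "((\<lambda>t. exp (F t p)) has_real_derivative exp (F x p) * dx F x p) (at x)" for x p
      by (rule DERIV_fun_exp F)+
    show "((\<lambda>t. exp (F x (p(k := t)))) has_real_derivative exp (F x p) * dp k F x p) (at (p k))" for k x p
      by (rule DERIV_cong, rule DERIV_fun_exp, rule F) simp
  qed (intro Cr_mult Suc.IH F Suc.prems[THEN Cr_Suc_imp])+
qed

text \<open>
  Reciprocals are the derivatives of logarithms, and \<open>R\<close> is the logarithm of \<open>1 / \<rho>\<close>.
\<close>

lemma Cr_inverse:
  "Cr r F \<Longrightarrow> (\<And>x p. F x p \<noteq> 0) \<Longrightarrow> Cr r (\<lambda>x p. inverse (F x p))"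
proof (induction r arbitrary: F)
  case 0
  then show ?case by (auto simp: split_def intro!: continuous_intros)
next
  case (Suc r)
  note F = Cr_SucD[OF Suc.prems(1)]
  have "Cr 0 (\<lambda>x p. inverse (F x p))"
    using Cr_imp_Cr_0[OF Suc.prems(1)] Suc.prems(2) by (auto simp: split_def intro!: continuous_intros)
  then show ?case
  proof (rule Cr_SucI)
    show "((\<lambda>t. inverse (F t p)) has_real_derivative
        (-1) * (inverse (F x p) * dx F x p * inverse (F x p))) (at x)" for x p
      by (rule DERIV_cong, rule DERIV_inverse', rule F) (simp_all add: Suc.prems(2))
    show "((\<lambda>t. inverse (F x (p(k := t)))) has_real_derivative
        (-1) * (inverse (F x p) * dp k F x p * inverse (F x p))) (at (p k))" for k x p
      by (rule DERIV_cong, rule DERIV_inverse', rule F) (simp_all add: Suc.prems(2))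
  qed (intro Cr_mult Cr_const Suc.IH F Suc.prems(1)[THEN Cr_Suc_imp] Suc.prems(2))+
qed

lemma Cr_ln:
  assumes "Cr r F" "\<And>x p. F x p > 0"
  shows "Cr r (\<lambda>x p. ln (F x p))"
proof -
  have cont: "Cr 0 (\<lambda>x p. ln (F x p))"
    using Cr_imp_Cr_0[OF assms(1)] less_imp_neq[OF assms(2), symmetric]
    by (simp add: split_def continuous_on_ln)
  show ?thesis
  proof (cases r)
    case (Suc s)
    note F = Cr_SucD[OF assms(1)[unfolded Suc]]
    show ?thesis unfolding Suc
    proof (rule Cr_SucI[OF cont])
      show "((\<lambda>t. ln (F t p)) has_real_derivative inverse (F x p) * dx F x p) (at x)" for x p
        by (rule DERIV_cong, rule DERIV_chain2, rule DERIV_ln, rule assms(2), rule F) simp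
      show "((\<lambda>t. ln (F x (p(k := t)))) has_real_derivative inverse (F x p) * dp k F x p) (at (p k))" for k x p
        by (rule DERIV_cong, rule DERIV_chain2, rule DERIV_ln, rule assms(2), rule F) simp
    qed (intro Cr_mult Cr_inverse F Cr_Suc_imp[OF assms(1)[unfolded Suc]] less_imp_neq[OF assms(2), symmetric])+
  qed (use cont in simp)
qed

section \<open>Antiderivatives\<close>

lemma integral_from_0_deriv:
  fixes g :: "real \<Rightarrow> real"
  assumes "continuous_on UNIV g"
  shows "((\<lambda>u. LBINT t=0..ereal u. g t) has_real_derivative g u) (at u)"
proof -
  let ?a = "- \<bar>u\<bar> - 1" and ?b = "\<bar>u\<bar> + 1"
  have "((\<lambda>v. LBINT t=ereal 0..ereal v. g t) has_vector_derivative g u) (at u within {?a..?b})"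
    by (rule interval_integral_FTC2) (auto intro: continuous_on_subset[OF assms])
  then have "((\<lambda>v. LBINT t=ereal 0..ereal v. g t) has_vector_derivative g u) (at u within {?a<..<?b})"
    by (rule has_vector_derivative_within_subset) auto
  then show ?thesis
    by (subst (asm) has_vector_derivative_within_open)
      (auto simp: has_real_derivative_iff_has_vector_derivative zero_ereal_def)
qed

text \<open>
  Rescaling to the fixed domain \<open>[0, 1]\<close> removes the moving upper limit together with the case
  distinction on its sign, so that the theorems on integrals with parameters apply.
\<close>

lemma integral_from_0_eq_unit_interval:
  fixes g :: "real \<Rightarrow> real"
  assumes "continuous_on UNIV g"
  shows "(LBINT t=0..ereal u. g t) = integral (cbox 0 1) (\<lambda>s. u * g (s * u))"
proof -
  let ?P = "\<lambda>u. LBINT t=0..ereal u. g t"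
  have "integral {0..1} (\<lambda>s. u * g (s * u)) = ?P (1 * u) - ?P (0 * u)"
  proof (rule integral_unique, rule fundamental_theorem_of_calculus)
    fix s :: real
    have "((\<lambda>s. ?P (s * u)) has_real_derivative g (s * u) * u) (at s)"
      by (rule DERIV_chain2[OF integral_from_0_deriv[OF assms]]) (auto intro!: derivative_eq_intros)
    then show "((\<lambda>s. ?P (s * u)) has_vector_derivative u * g (s * u)) (at s within {0..1})"
      by (simp add: has_real_derivative_iff_has_vector_derivative mult.commute has_vector_derivative_at_within)
  qed simp
  moreover have "?P 0 = 0"
    by (simp add: zero_ereal_def[symmetric])
  ultimately show ?thesis
    by simp
qed

lemma continuous_on_jetfun:
  assumes "Cr 0 F" "continuous_on S a" "continuous_on S b"
  shows "continuous_on S (\<lambda>z. F (a z) (b z))"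
proof -
  have "continuous_on S ((\<lambda>(x, p). F x p) \<circ> (\<lambda>z. (a z, b z)))"
    using assms by (intro continuous_on_compose continuous_on_Pair) (auto intro: continuous_on_subset)
  then show ?thesis by (simp add: o_def)
qed

lemma continuous_on_fun_upd:
  fixes b :: "'a::topological_space \<Rightarrow> nat \<Rightarrow> real"
  assumes "continuous_on S b" "continuous_on S c"
  shows "continuous_on S (\<lambda>z. (b z)(k := c z))"
proof (rule continuous_on_coordinatewise_then_product)
  fix i show "continuous_on S (\<lambda>z. ((b z)(k := c z)) i)"
    using assms by (cases "i = k") (simp_all add: continuous_on_product_then_coordinatewise)
qed

lemma continuous_on_snd_coord:
  fixes g :: "'a::topological_space \<Rightarrow> 'b::topological_space \<times> (nat \<Rightarrow> real)"
  shows "continuous_on S g \<Longrightarrow> continuous_on S (\<lambda>z. snd (g z) k)"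
  by (rule continuous_on_product_then_coordinatewise[OF continuous_on_snd])

lemmas jet_continuous_intros =
  continuous_on_fun_upd continuous_on_snd_coord continuous_on_mult continuous_on_fst
  continuous_on_snd continuous_on_id continuous_on_const

lemma antider_eq_unit_interval:
  assumes "Cr 0 F"
  shows "antider k F x p = integral (cbox 0 1) (\<lambda>s. p k * F x (p(k := s * p k)))"
  unfolding antider_def
  by (rule integral_from_0_eq_unit_interval)
    (intro continuous_on_jetfun[OF assms] jet_continuous_intros)

lemma Cr_0_antider:
  assumes "Cr 0 F"
  shows "Cr 0 (antider k F)"
proof -
  have "continuous_on (UNIV \<times> cbox 0 1) (\<lambda>(z, s). snd z k * F (fst z) ((snd z)(k := s * snd z k)))"
    unfolding split_def
    by (intro continuous_on_jetfun[OF assms] jet_continuous_intros)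
  then have "continuous_on UNIV (\<lambda>z. integral (cbox 0 1) (\<lambda>s::real. snd z k * F (fst z) ((snd z)(k := s * snd z k))))"
    by (rule integral_continuous_on_param)
  then show ?thesis
    by (simp add: antider_eq_unit_interval[OF assms] split_def)
qed

lemma has_dx_antider:
  assumes "Cr 0 F" "Cr 0 F'"
    and "\<And>x p. ((\<lambda>t. F t p) has_real_derivative F' x p) (at x)"
  shows "((\<lambda>t. antider k F t p) has_real_derivative antider k F' x p) (at x)"
  unfolding antider_eq_unit_interval[OF assms(1)] antider_eq_unit_interval[OF assms(2)]
proof (rule leibniz_rule_field_derivative[where U = UNIV])
  show "((\<lambda>t. p k * F t (p(k := s * p k))) has_real_derivative p k * F' y (p(k := s * p k))) (at y)" for y s
    by (intro DERIV_cmult assms(3))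
  show "(\<lambda>s. p k * F y (p(k := s * p k))) integrable_on cbox 0 1" for y
    by (intro integrable_continuous continuous_on_jetfun[OF assms(1)] jet_continuous_intros)
  show "continuous_on (UNIV \<times> cbox 0 1) (\<lambda>(y, s). p k * F' y (p(k := s * p k)))"
    unfolding split_def
    by (intro continuous_on_jetfun[OF assms(2)] jet_continuous_intros)
qed (rule UNIV_I convex_UNIV)+

text \<open>
  Differentiation under the integral sign. As with \<open>has_dx_antider\<close>, the derivative of the integrand
  must be jointly continuous, which is what \<open>Cr 0 F'\<close> provides on the compact domain of integration.
\<close>

lemma has_dp_antider_other:
  assumes "Cr 0 F" "Cr 0 F'" and "j \<noteq> k"
    and "\<And>x p. ((\<lambda>t. F x (p(j := t))) has_real_derivative F' x p) (at (p j))"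
  shows "((\<lambda>t. antider k F x (p(j := t))) has_real_derivative antider k F' x p) (at (p j))"
proof -
  have "((\<lambda>t. integral (cbox 0 1) (\<lambda>s. p k * F x (p(k := s * p k, j := t)))) has_real_derivative
        integral (cbox 0 1) (\<lambda>s. p k * F' x (p(k := s * p k, j := p j)))) (at (p j))"
  proof (rule leibniz_rule_field_derivative[where U = UNIV])
    show "((\<lambda>t. p k * F x (p(k := s * p k, j := t))) has_real_derivative
        p k * F' x (p(k := s * p k, j := t))) (at t)" for t s
      by (rule DERIV_cmult, rule has_dp_along_line[where F = F and F' = F', OF assms(4)])
    show "(\<lambda>s. p k * F x (p(k := s * p k, j := y))) integrable_on cbox 0 1" for y
      by (intro integrable_continuous continuous_on_jetfun[OF assms(1)] jet_continuous_intros)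
    show "continuous_on (UNIV \<times> cbox 0 1) (\<lambda>(y, s). p k * F' x (p(k := s * p k, j := y)))"
      unfolding split_def
      by (intro continuous_on_jetfun[OF assms(2)] jet_continuous_intros)
  qed (rule UNIV_I convex_UNIV)+
  moreover have "p(k := s, j := p j) = p(k := s)" for s
    using assms(3) by auto
  ultimately show ?thesis
    using assms(3)
    by (simp add: antider_eq_unit_interval[OF assms(1)] antider_eq_unit_interval[OF assms(2)]
        fun_upd_twist[of j k])
qed

lemma has_dp_antider_same:
  assumes "Cr 0 F"
  shows "((\<lambda>t. antider k F x (p(k := t))) has_real_derivative F x p) (at (p k))"
proof -
  have "continuous_on UNIV (\<lambda>t. F x (p(k := t)))"
    by (intro continuous_on_jetfun[OF assms] jet_continuous_intros)
  from integral_from_0_deriv[OF this, of "p k"] show ?thesis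
    by (simp add: antider_def)
qed

text \<open>
  The partial derivatives of an antiderivative are antiderivatives of partial derivatives of \<open>F\<close>,
  or \<open>F\<close> itself, hence the induction closes.
\<close>

lemma Cr_antider: "Cr r F \<Longrightarrow> Cr r (antider k F)"
proof (induction r arbitrary: F)
  case 0
  then show ?case by (rule Cr_0_antider)
next
  case (Suc r)
  note F = Cr_SucD[OF Suc.prems(1)] and F0 = Cr_imp_Cr_0[OF Suc.prems]
  show ?case
  proof (rule Cr_SucI)
    show "((\<lambda>t. antider k F t p) has_real_derivative antider k (dx F) x p) (at x)" for x p
      by (rule has_dx_antider[OF F0 Cr_imp_Cr_0[OF F(3)] F(1)])
    show "((\<lambda>t. antider k F x (p(j := t))) has_real_derivative
        (if j = k then F else antider k (dp j F)) x p) (at (p j))" for j x p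
      using has_dp_antider_same[OF F0] has_dp_antider_other[OF F0 Cr_imp_Cr_0[OF F(4)] _ F(2)] by simp
    show "Cr 0 (antider k F)" by (rule Cr_0_antider[OF F0])
    show "Cr r (if j = k then F else antider k (dp j F))" for j
      using Suc.IH[OF F(4)] Cr_Suc_imp[OF Suc.prems] by simp
  qed (intro Suc.IH F)
qed

section \<open>Calculus of smooth functions on the jet space\<close>

definition smooth :: "jetfun \<Rightarrow> bool" where
  "smooth F \<longleftrightarrow> (\<forall>r. Cr r F)"

lemma smooth_upto_iff: "smooth_upto k F \<longleftrightarrow> depends_upto k F \<and> smooth F"
  by (simp add: smooth_upto_def smooth_def)

lemma
  assumes "smooth F"
  shows smooth_has_dx: "((\<lambda>t. F t p) has_real_derivative dx F x p) (at x)"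
    and smooth_has_dp: "((\<lambda>t. F x (p(k := t))) has_real_derivative dp k F x p) (at (p k))"
    and smooth_dx: "smooth (dx F)"
    and smooth_dp: "smooth (dp k F)"
  using assms Cr_SucD[of _ F] unfolding smooth_def by metis+

lemma smooth_const: "smooth (\<lambda>x p. c)"
  by (simp add: smooth_def Cr_const)

lemma smooth_coord: "smooth (\<lambda>x p. p j)"
  by (simp add: smooth_def Cr_coord)

lemma smooth_add: "smooth F \<Longrightarrow> smooth G \<Longrightarrow> smooth (\<lambda>x p. F x p + G x p)"
  by (simp add: smooth_def Cr_add)

lemma smooth_mult: "smooth F \<Longrightarrow> smooth G \<Longrightarrow> smooth (\<lambda>x p. F x p * G x p)"
  by (simp add: smooth_def Cr_mult)

lemma smooth_minus: "smooth F \<Longrightarrow> smooth (\<lambda>x p. - F x p)"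
  using smooth_mult[OF smooth_const[of "-1"], of F] by simp

lemma smooth_diff: "smooth F \<Longrightarrow> smooth G \<Longrightarrow> smooth (\<lambda>x p. F x p - G x p)"
  using smooth_add[OF _ smooth_minus, of F G] by simp

lemma smooth_exp: "smooth F \<Longrightarrow> smooth (\<lambda>x p. exp (F x p))"
  by (simp add: smooth_def Cr_exp)

lemma smooth_ln: "smooth F \<Longrightarrow> (\<And>x p. F x p > 0) \<Longrightarrow> smooth (\<lambda>x p. ln (F x p))"
  by (simp add: smooth_def Cr_ln)

lemma smooth_antider: "smooth F \<Longrightarrow> smooth (antider k F)"
  by (simp add: smooth_def Cr_antider)

lemma smooth_sum: "(\<And>i. i \<in> I \<Longrightarrow> smooth (F i)) \<Longrightarrow> smooth (\<lambda>x p. \<Sum>i\<in>I. F i x p)"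
proof (induction I rule: infinite_finite_induct)
  case (insert i I)
  then show ?case using smooth_add[of "F i" "\<lambda>x p. \<Sum>i\<in>I. F i x p"] by simp
qed (simp_all add: smooth_const)

lemma antider2_eq: "antider2 k F = antider k (antider k F)"
  by (simp add: antider2_def antider_def fun_eq_iff)

lemma dx_const: "dx (\<lambda>x p. c) = (\<lambda>x p. 0)"
  by (rule dx_eqI) (rule DERIV_const)

lemma dp_const: "dp k (\<lambda>x p. c) = (\<lambda>x p. 0)"
  by (rule dp_eqI) (rule DERIV_const)

lemma dx_add: "smooth F \<Longrightarrow> smooth G \<Longrightarrow> dx (\<lambda>x p. F x p + G x p) = (\<lambda>x p. dx F x p + dx G x p)"
  by (rule dx_eqI) (rule DERIV_add[OF smooth_has_dx smooth_has_dx])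

lemma dp_add: "smooth F \<Longrightarrow> smooth G \<Longrightarrow> dp k (\<lambda>x p. F x p + G x p) = (\<lambda>x p. dp k F x p + dp k G x p)"
  by (rule dp_eqI) (rule DERIV_add[OF smooth_has_dp smooth_has_dp])

lemma dx_mult:
  "smooth F \<Longrightarrow> smooth G \<Longrightarrow> dx (\<lambda>x p. F x p * G x p) = (\<lambda>x p. dx F x p * G x p + F x p * dx G x p)"
  by (rule dx_eqI) (rule DERIV_cong[OF DERIV_mult[OF smooth_has_dx smooth_has_dx]], auto)

lemma dp_mult:
  "smooth F \<Longrightarrow> smooth G \<Longrightarrow>
    dp k (\<lambda>x p. F x p * G x p) = (\<lambda>x p. dp k F x p * G x p + F x p * dp k G x p)"
  by (rule dp_eqI) (rule DERIV_cong[OF DERIV_mult[OF smooth_has_dp smooth_has_dp]], auto)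

lemma dx_cmult: "smooth F \<Longrightarrow> dx (\<lambda>x p. c * F x p) = (\<lambda>x p. c * dx F x p)"
  by (simp add: dx_mult[OF smooth_const] dx_const)

lemma dp_cmult: "smooth F \<Longrightarrow> dp k (\<lambda>x p. c * F x p) = (\<lambda>x p. c * dp k F x p)"
  by (simp add: dp_mult[OF smooth_const] dp_const)

lemma dp_diff: "smooth F \<Longrightarrow> smooth G \<Longrightarrow> dp k (\<lambda>x p. F x p - G x p) = (\<lambda>x p. dp k F x p - dp k G x p)"
  by (rule dp_eqI) (rule DERIV_diff[OF smooth_has_dp smooth_has_dp])

lemma dx_coord: "dx (\<lambda>x p. p j) = (\<lambda>x p. 0)"
  by (rule dx_eqI) (rule DERIV_const)

lemma dp_coord: "dp k (\<lambda>x p. p j) = (\<lambda>x p. if k = j then 1 else 0)"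
  by (rule dp_eqI) (auto intro!: derivative_eq_intros)

lemma dx_exp_neg: "smooth R \<Longrightarrow> dx (exp_neg R) = (\<lambda>x p. - (exp_neg R x p * dx R x p))"
  unfolding exp_neg_def
  by (rule dx_eqI) (rule DERIV_cong[OF DERIV_fun_exp[OF DERIV_minus[OF smooth_has_dx]]], auto)

lemma dp_exp_neg: "smooth R \<Longrightarrow> dp k (exp_neg R) = (\<lambda>x p. - (exp_neg R x p * dp k R x p))"
  unfolding exp_neg_def
  by (rule dp_eqI) (rule DERIV_cong[OF DERIV_fun_exp[OF DERIV_minus[OF smooth_has_dp]]], auto)

lemma smooth_exp_neg: "smooth R \<Longrightarrow> smooth (exp_neg R)"
  unfolding exp_neg_def by (intro smooth_exp smooth_minus)

lemma smooth_imp_Cr: "smooth F \<Longrightarrow> Cr r F"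
  by (simp add: smooth_def)

lemma dx_antider: "smooth F \<Longrightarrow> dx (antider k F) = antider k (dx F)"
  by (rule dx_eqI) (rule has_dx_antider, (rule smooth_imp_Cr smooth_dx smooth_has_dx | assumption)+)

lemma dp_antider_other: "smooth F \<Longrightarrow> j \<noteq> k \<Longrightarrow> dp j (antider k F) = antider k (dp j F)"
  by (rule dp_eqI) (rule has_dp_antider_other, (rule smooth_imp_Cr smooth_dp smooth_has_dp | assumption)+)

lemma dp_antider_same: "smooth F \<Longrightarrow> dp k (antider k F) = F"
  by (rule dp_eqI) (rule has_dp_antider_same, rule smooth_imp_Cr)

lemma dp_zero_imp_const:
  assumes "smooth F" "dp k F = (\<lambda>x p. 0)"
  shows "F x (p(k := u)) = F x (p(k := v))"
proof -
  have "((\<lambda>t. F x (p(k := t))) has_real_derivative 0) (at t)" for t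
    using has_dp_along_line[of F k "dp k F", OF smooth_has_dp[OF assms(1)]] by (simp add: assms(2))
  then show ?thesis
    using DERIV_isconst_all by blast
qed

text \<open>
  The fundamental theorem of calculus in the coordinate \<open>p\<^sub>k\<close>. The symmetry of mixed partial
  derivatives is deduced from it: differentiate this identity by another variable under the integral
  sign, and then by \<open>p\<^sub>k\<close>, which removes the integral.
\<close>

lemma eq_antider_dp:
  assumes "smooth F"
  shows "F x p = F x (p(k := 0)) + antider k (dp k F) x p"
proof -
  let ?G = "\<lambda>x p. F x p - antider k (dp k F) x p"
  have "dp k ?G = (\<lambda>x p. 0)"
    by (simp add: dp_diff dp_antider_same smooth_antider smooth_dp assms)
  then have "?G x (p(k := p k)) = ?G x (p(k := 0))"
    by (intro dp_zero_imp_const smooth_diff smooth_antider smooth_dp assms)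
  moreover have "antider k (dp k F) x (p(k := 0)) = 0"
    by (simp add: antider_def zero_ereal_def[symmetric])
  ultimately show ?thesis by simp
qed

lemma dp_dx_commute:
  assumes "smooth F"
  shows "dp k (dx F) = dx (dp k F)"
proof (rule dp_eqI)
  fix x :: real and p :: "nat \<Rightarrow> real"
  have "((\<lambda>t. F t q) has_real_derivative dx F x (q(k := 0)) + antider k (dx (dp k F)) x q) (at x)" for q
    by (subst eq_antider_dp[OF assms, of _ q k])
      (intro DERIV_add smooth_has_dx[OF assms]
        smooth_has_dx[OF smooth_antider[OF smooth_dp[OF assms]], unfolded dx_antider[OF smooth_dp[OF assms]]])
  note split = DERIV_unique[OF smooth_has_dx[OF assms] this]
  have "(\<lambda>t. dx F x (p(k := t))) = (\<lambda>t. dx F x (p(k := 0)) + antider k (dx (dp k F)) x (p(k := t)))"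
    by (rule ext) (rule split[of "p(k := t)" for t, unfolded fun_upd_upd])
  then show "((\<lambda>t. dx F x (p(k := t))) has_real_derivative dx (dp k F) x p) (at (p k))"
    using DERIV_add[OF DERIV_const has_dp_antider_same[OF smooth_imp_Cr[OF smooth_dx[OF smooth_dp[OF assms]]]]]
    by simp
qed

lemma dp_dp_commute:
  assumes "smooth F"
  shows "dp k (dp j F) = dp j (dp k F)"
proof (cases "j = k")
  case False
  show ?thesis
  proof (rule dp_eqI)
    fix x :: real and p :: "nat \<Rightarrow> real"
    have "((\<lambda>t. F x (q(j := t))) has_real_derivative
        dp j F x (q(k := 0)) + antider k (dp j (dp k F)) x q) (at (q j))" for q
    proof -
      have "F x (q(j := t)) = F x (q(k := 0, j := t)) + antider k (dp k F) x (q(j := t))" for t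
        using eq_antider_dp[OF assms, of x "q(j := t)" k] False by (simp add: fun_upd_twist)
      moreover have "((\<lambda>t. F x (q(k := 0, j := t))) has_real_derivative dp j F x (q(k := 0))) (at (q j))"
        using smooth_has_dp[OF assms, where x = x and p = "q(k := 0)" and k = j] False by simp
      moreover have "((\<lambda>t. antider k (dp k F) x (q(j := t))) has_real_derivative
          antider k (dp j (dp k F)) x q) (at (q j))"
        using smooth_has_dp[OF smooth_antider[OF smooth_dp[OF assms]]]
        unfolding dp_antider_other[OF smooth_dp[OF assms] False, symmetric] .
      ultimately show ?thesis
        by (simp only: DERIV_add)
    qed
    note split = DERIV_unique[OF smooth_has_dp[OF assms] this]
    have "(\<lambda>t. dp j F x (p(k := t))) = (\<lambda>t. dp j F x (p(k := 0)) + antider k (dp j (dp k F)) x (p(k := t)))"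
      by (rule ext) (rule split[of "p(k := t)" for t, unfolded fun_upd_upd])
    then show "((\<lambda>t. dp j F x (p(k := t))) has_real_derivative dp j (dp k F) x p) (at (p k))"
      using DERIV_add[OF DERIV_const has_dp_antider_same[OF smooth_imp_Cr[OF smooth_dp[OF smooth_dp[OF assms]]]]]
      by simp
  qed
qed simp

section \<open>Order of a function\<close>

lemma depends_uptoD: "depends_upto k F \<Longrightarrow> (\<And>i. i \<le> k \<Longrightarrow> p i = q i) \<Longrightarrow> F x p = F x q"
  by (simp add: depends_upto_def)

lemma depends_upto_mono: "depends_upto k F \<Longrightarrow> k \<le> l \<Longrightarrow> depends_upto l F"
  unfolding depends_upto_def by (meson order_trans)

lemma depends_upto_const: "depends_upto k (\<lambda>x p. c)"
  by (simp add: depends_upto_def)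

lemma depends_upto_coord: "j \<le> k \<Longrightarrow> depends_upto k (\<lambda>x p. p j)"
  by (simp add: depends_upto_def)

lemma depends_upto_add: "depends_upto k F \<Longrightarrow> depends_upto k G \<Longrightarrow> depends_upto k (\<lambda>x p. F x p + G x p)"
  unfolding depends_upto_def by (intro allI impI arg_cong2[where f = "(+)"]) blast+

lemma depends_upto_diff: "depends_upto k F \<Longrightarrow> depends_upto k G \<Longrightarrow> depends_upto k (\<lambda>x p. F x p - G x p)"
  unfolding depends_upto_def by (intro allI impI arg_cong2[where f = "(-)"]) blast+

lemma depends_upto_mult: "depends_upto k F \<Longrightarrow> depends_upto k G \<Longrightarrow> depends_upto k (\<lambda>x p. F x p * G x p)"
  unfolding depends_upto_def by (intro allI impI arg_cong2[where f = "(*)"]) blast+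

lemma depends_upto_comp: "depends_upto k F \<Longrightarrow> depends_upto k (\<lambda>x p. h (F x p))"
  unfolding depends_upto_def by (intro allI impI arg_cong[where f = h]) blast

lemma depends_upto_sum:
  "(\<And>i. i \<in> I \<Longrightarrow> depends_upto k (F i)) \<Longrightarrow> depends_upto k (\<lambda>x p. \<Sum>i\<in>I. F i x p)"
  unfolding depends_upto_def by (intro allI impI sum.cong refl) blast

lemma depends_upto_exp_neg: "depends_upto k R \<Longrightarrow> depends_upto k (exp_neg R)"
  unfolding exp_neg_def by (rule depends_upto_comp)

lemma depends_upto_dx:
  assumes "depends_upto k F"
  shows "depends_upto k (dx F)"
  unfolding depends_upto_def
proof (intro allI impI)
  fix x :: real and p q :: "nat \<Rightarrow> real"
  assume "\<forall>i\<le>k. p i = q i"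
  then have "(\<lambda>t. F t p) = (\<lambda>t. F t q)"
    by (intro ext depends_uptoD[OF assms]) auto
  then show "dx F x p = dx F x q"
    by (simp add: dx_def)
qed

lemma dp_beyond:
  assumes "depends_upto k F" "k < j"
  shows "dp j F = (\<lambda>x p. 0)"
proof (rule dp_eqI)
  fix x :: real and p :: "nat \<Rightarrow> real"
  have "(\<lambda>t. F x (p(j := t))) = (\<lambda>t. F x p)"
    using assms(2) by (intro ext depends_uptoD[OF assms(1)]) auto
  then show "((\<lambda>t. F x (p(j := t))) has_real_derivative 0) (at (p j))"
    by simp
qed

lemma depends_upto_dp:
  assumes "depends_upto k F"
  shows "depends_upto k (dp j F)"
proof (cases "j \<le> k")
  case True
  have "dp j F x p = dp j F x q" if "\<forall>i\<le>k. p i = q i" for x p q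
  proof -
    have "(\<lambda>t. F x (p(j := t))) = (\<lambda>t. F x (q(j := t)))"
      using that by (intro ext depends_uptoD[OF assms]) auto
    then show ?thesis
      using that True by (simp add: dp_def)
  qed
  then show ?thesis by (simp add: depends_upto_def)
next
  case False
  then show ?thesis by (simp add: dp_beyond[OF assms] depends_upto_const)
qed

lemma depends_upto_antider:
  assumes "depends_upto k F" "j \<le> k"
  shows "depends_upto k (antider j F)"
proof -
  have "antider j F x p = antider j F x q" if "\<forall>i\<le>k. p i = q i" for x p q
  proof -
    have "F x (p(j := t)) = F x (q(j := t))" for t
      using that by (intro depends_uptoD[OF assms(1)]) auto
    then show ?thesis
      using that assms(2) by (simp add: antider_def)
  qed
  then show ?thesis by (simp add: depends_upto_def)
qed

text \<open>
  The way in which the order of a Lagrangian is reduced.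
\<close>

lemma depends_upto_lower:
  assumes "smooth F" "depends_upto (Suc k) F" "dp (Suc k) F = (\<lambda>x p. 0)"
  shows "depends_upto k F"
  unfolding depends_upto_def
proof (intro allI impI)
  fix x :: real and p q :: "nat \<Rightarrow> real"
  assume *: "\<forall>i\<le>k. p i = q i"
  have "F x p = F x (p(Suc k := q (Suc k)))"
    using dp_zero_imp_const[OF assms(1,3), of x p "p (Suc k)"] by simp
  also have "\<dots> = F x q"
    using * by (intro depends_uptoD[OF assms(2)]) (auto simp: le_Suc_eq)
  finally show "F x p = F x q" .
qed

section \<open>Total derivatives\<close>

lemma smooth_Dtot: "smooth F \<Longrightarrow> smooth (Dtot m F)"
  unfolding Dtot_def by (intro smooth_add smooth_dx smooth_sum smooth_mult smooth_coord smooth_dp)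

lemma smooth_Dtot_pow: "smooth F \<Longrightarrow> smooth ((Dtot m ^^ k) F)"
  by (induction k) (auto intro: smooth_Dtot)

lemma smooth_Eul: "smooth F \<Longrightarrow> smooth (Eul m n F)"
  unfolding Eul_def by (intro smooth_sum smooth_mult smooth_const smooth_Dtot_pow smooth_dp)

lemma Dtot_const: "Dtot m (\<lambda>x p. c) = (\<lambda>x p. 0)"
  by (simp add: Dtot_def dx_const dp_const)

lemma Dtot_add:
  "smooth F \<Longrightarrow> smooth G \<Longrightarrow> Dtot m (\<lambda>x p. F x p + G x p) = (\<lambda>x p. Dtot m F x p + Dtot m G x p)"
  by (simp add: Dtot_def dx_add dp_add algebra_simps sum.distrib)

lemma Dtot_cmult: "smooth F \<Longrightarrow> Dtot m (\<lambda>x p. c * F x p) = (\<lambda>x p. c * Dtot m F x p)"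
  by (simp add: Dtot_def dx_cmult dp_cmult algebra_simps sum_distrib_left)

lemma Dtot_pow_const: "(Dtot m ^^ k) (\<lambda>x p. 0) = (\<lambda>x p. 0)"
  by (induction k) (auto simp: Dtot_const)

lemma Dtot_pow_add:
  "smooth F \<Longrightarrow> smooth G \<Longrightarrow>
    (Dtot m ^^ k) (\<lambda>x p. F x p + G x p) = (\<lambda>x p. (Dtot m ^^ k) F x p + (Dtot m ^^ k) G x p)"
  by (induction k) (auto simp: Dtot_add smooth_Dtot_pow)

lemma Dtot_pow_cmult:
  "smooth F \<Longrightarrow> (Dtot m ^^ k) (\<lambda>x p. c * F x p) = (\<lambda>x p. c * (Dtot m ^^ k) F x p)"
  by (induction k) (auto simp: Dtot_cmult smooth_Dtot_pow)

lemma Eul_add: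
  "smooth F \<Longrightarrow> smooth G \<Longrightarrow> Eul m n (\<lambda>x p. F x p + G x p) = (\<lambda>x p. Eul m n F x p + Eul m n G x p)"
  by (simp add: Eul_def dp_add Dtot_pow_add smooth_dp algebra_simps sum.distrib)

lemma Eul_cmult: "smooth F \<Longrightarrow> Eul m n (\<lambda>x p. c * F x p) = (\<lambda>x p. c * Eul m n F x p)"
  by (simp add: Eul_def dp_cmult Dtot_pow_cmult smooth_dp algebra_simps sum_distrib_left)

lemma Eul_zero: "Eul m n (\<lambda>x p. 0) = (\<lambda>x p. 0)"
  by (simp add: Eul_def dp_const Dtot_pow_const)

lemma Eul_sum:
  assumes "finite I" "\<And>i. i \<in> I \<Longrightarrow> smooth (F i)"
  shows "Eul m n (\<lambda>x p. \<Sum>i\<in>I. F i x p) = (\<lambda>x p. \<Sum>i\<in>I. Eul m n (F i) x p)"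
  using assms by (induction I rule: finite_induct) (auto simp: Eul_zero Eul_add smooth_sum)

lemma Dtot_Suc: "Dtot (Suc m) F = (\<lambda>x p. Dtot m F x p + p (Suc m) * dp m F x p)"
  by (simp add: Dtot_def algebra_simps)

lemma Dtot_coord_mult:
  assumes "smooth F" "j < m"
  shows "Dtot m (\<lambda>x p. p j * F x p) = (\<lambda>x p. p (Suc j) * F x p + p j * Dtot m F x p)"
proof (intro ext)
  fix x :: real and p :: "nat \<Rightarrow> real"
  have "(\<Sum>i<m. p (Suc i) * ((if i = j then 1 else 0) * F x p + p j * dp i F x p)) =
    (\<Sum>i<m. (if i = j then p (Suc j) * F x p else 0)) + p j * (\<Sum>i<m. p (Suc i) * dp i F x p)"
    unfolding sum_distrib_left sum.distrib[symmetric]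
    by (rule sum.cong) (auto simp: algebra_simps)
  then show "Dtot m (\<lambda>x p. p j * F x p) x p = p (Suc j) * F x p + p j * Dtot m F x p"
    using assms(2)
    by (simp add: Dtot_def dx_mult[OF smooth_coord assms(1)] dp_mult[OF smooth_coord assms(1)]
        dx_coord dp_coord algebra_simps)
qed

lemma Dtot_exp_neg: "smooth R \<Longrightarrow> Dtot m (exp_neg R) = (\<lambda>x p. - (exp_neg R x p * Dtot m R x p))"
  by (simp add: Dtot_def dx_exp_neg dp_exp_neg algebra_simps sum_distrib_left sum_negf)

text \<open>
  A total derivative raises the order by one, unless the truncation index \<open>m\<close> is already reached.
\<close>

lemma depends_upto_Dtot:
  assumes "depends_upto j F" "j \<le> l" "min m (Suc j) \<le> l"
  shows "depends_upto l (Dtot m F)"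
proof -
  have "depends_upto l (\<lambda>x p. p (Suc i) * dp i F x p)" if "i < m" for i
  proof (cases "i \<le> j")
    case True
    with assms that show ?thesis
      by (intro depends_upto_mult depends_upto_coord depends_upto_dp depends_upto_mono[OF assms(1)]) auto
  next
    case False
    then show ?thesis by (simp add: dp_beyond[OF assms(1)] depends_upto_const)
  qed
  then show ?thesis
    unfolding Dtot_def
    by (intro depends_upto_add depends_upto_dx depends_upto_sum depends_upto_mono[OF assms(1,2)]) auto
qed

lemma depends_upto_Dtot_pow:
  assumes "depends_upto j F" "j \<le> m"
  shows "depends_upto m ((Dtot m ^^ k) F)"
proof (induction k)
  case 0
  show ?case using depends_upto_mono[OF assms] by simp
next
  case (Suc k)
  then show ?case by (simp add: depends_upto_Dtot)
qed

lemma depends_upto_Dtot_pow_add: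
  "depends_upto j F \<Longrightarrow> depends_upto (j + k) ((Dtot m ^^ k) F)"
  by (induction k) (auto intro: depends_upto_Dtot)

lemma depends_upto_Eul:
  assumes "depends_upto j F" "j \<le> m"
  shows "depends_upto m (Eul m n F)"
  unfolding Eul_def
  by (intro depends_upto_sum depends_upto_mult depends_upto_const depends_upto_Dtot_pow[OF _ assms(2)]
      depends_upto_dp assms(1))

text \<open>
  On functions of order \<open>j\<close> every truncation beyond \<open>j\<close> is the full total derivative.
\<close>

lemma Dtot_trunc:
  assumes "depends_upto j F" "j < m"
  shows "Dtot m F = Dtot (Suc j) F"
proof (intro ext)
  fix x :: real and p :: "nat \<Rightarrow> real"
  have "(\<Sum>i<m. p (Suc i) * dp i F x p) = (\<Sum>i<Suc j. p (Suc i) * dp i F x p)"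
    using assms by (intro sum.mono_neutral_right) (auto simp: dp_beyond[OF assms(1)])
  then show "Dtot m F x p = Dtot (Suc j) F x p"
    by (simp add: Dtot_def)
qed

lemma Dtot_pow_trunc:
  assumes "depends_upto j F" "j + k \<le> m" "j + k \<le> m'"
  shows "(Dtot m ^^ k) F = (Dtot m' ^^ k) F"
  using assms(2,3)
proof (induction k)
  case (Suc k)
  have "depends_upto (j + k) ((Dtot m' ^^ k) F)"
    by (rule depends_upto_Dtot_pow_add[OF assms(1)])
  from Dtot_trunc[OF this, of m] Dtot_trunc[OF this, of m'] Suc show ?case by simp
qed simp

text \<open>
  The commutator of \<open>\<partial>\<^sub>k\<close> and \<open>D\<^sub>m\<close> is \<open>\<partial>\<^sub>k\<^sub>-\<^sub>1\<close> if \<open>1 \<le> k \<le> m\<close> and zero otherwise; the sum picks the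
  single coefficient \<open>p\<^sub>k\<close> of \<open>D\<^sub>m\<close> that \<open>\<partial>\<^sub>k\<close> sees.
\<close>

lemma dp_Dtot:
  assumes "smooth F"
  shows "dp k (Dtot m F) = (\<lambda>x p. Dtot m (dp k F) x p + (\<Sum>i<m. if Suc i = k then dp i F x p else 0))"
proof (rule dp_eqI)
  fix x :: real and p :: "nat \<Rightarrow> real"
  have coord: "((\<lambda>t. (p(k := t)) (Suc i)) has_real_derivative (if Suc i = k then 1 else 0)) (at (p k))" for i
    by (auto intro!: derivative_eq_intros)
  have "((\<lambda>t. Dtot m F x (p(k := t))) has_real_derivative
      dp k (dx F) x p + (\<Sum>i<m. (if Suc i = k then 1 else 0) * dp i F x (p(k := p k)) +
        dp k (dp i F) x p * (p(k := p k)) (Suc i))) (at (p k))"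
    unfolding Dtot_def
    by (intro DERIV_add DERIV_sum DERIV_mult coord smooth_has_dp smooth_dx smooth_dp assms)
  also have "dp k (dx F) x p + (\<Sum>i<m. (if Suc i = k then 1 else 0) * dp i F x (p(k := p k)) +
        dp k (dp i F) x p * (p(k := p k)) (Suc i)) =
      Dtot m (dp k F) x p + (\<Sum>i<m. if Suc i = k then dp i F x p else 0)"
    by (simp add: Dtot_def dp_dx_commute[OF assms] dp_dp_commute[OF assms, of k] sum.distrib
        if_distrib[of "\<lambda>c. _ * c"] algebra_simps cong: if_cong)
  finally show "((\<lambda>t. Dtot m F x (p(k := t))) has_real_derivative
      Dtot m (dp k F) x p + (\<Sum>i<m. if Suc i = k then dp i F x p else 0)) (at (p k))" .
qed

lemma dp_0_Dtot: "smooth F \<Longrightarrow> dp 0 (Dtot m F) = Dtot m (dp 0 F)"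
  by (simp add: dp_Dtot)

lemma dp_Suc_Dtot:
  "smooth F \<Longrightarrow> k < m \<Longrightarrow> dp (Suc k) (Dtot m F) = (\<lambda>x p. Dtot m (dp (Suc k) F) x p + dp k F x p)"
  by (simp add: dp_Dtot)

text \<open>
  Iterating the commutator: at the top order \<open>j + k\<close> the term with \<open>D\<^sub>m\<close> always vanishes.
\<close>

lemma dp_top_Dtot_pow:
  assumes "smooth F" "depends_upto j F" "j + k \<le> m"
  shows "dp (j + k) ((Dtot m ^^ k) F) = dp j F"
  using assms(3)
proof (induction k)
  case (Suc k)
  have "dp (Suc (j + k)) ((Dtot m ^^ k) F) = (\<lambda>x p. 0)"
    by (rule dp_beyond[OF depends_upto_Dtot_pow_add[OF assms(2)]]) simp
  with Suc show ?case
    by (simp add: dp_Suc_Dtot smooth_Dtot_pow assms(1) Dtot_const)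
qed simp

text \<open>
  One order below the top, each of the \<open>k\<close> commutations contributes one copy of \<open>D\<^sub>m \<partial>\<^sub>j\<^sub>+\<^sub>1 F\<close>.
  This is the origin of the factor \<open>n\<close> in the formula for \<open>f\<^sub>2\<^sub>n\<^sub>-\<^sub>1\<close>.
\<close>

lemma dp_below_top_Dtot_pow:
  assumes "smooth F" "depends_upto (Suc j) F" "Suc j + k \<le> m"
  shows "dp (j + k) ((Dtot m ^^ k) F) = (\<lambda>x p. real k * Dtot m (dp (Suc j) F) x p + dp j F x p)"
  using assms(3)
proof (induction k)
  case (Suc k)
  have "dp (Suc (j + k)) ((Dtot m ^^ k) F) = dp (Suc j) F"
    using dp_top_Dtot_pow[OF assms(1,2), of k m] Suc.prems by simp
  with Suc show ?case
    by (simp add: dp_Suc_Dtot smooth_Dtot_pow assms(1) algebra_simps)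
qed simp

section \<open>The Euler operators\<close>

text \<open>
  Total derivatives are null Lagrangians: by the commutator rule the alternating sum telescopes, and
  what remains is \<open>(-1)\<^sup>n D\<^sup>n\<^sup>+\<^sup>1 \<partial>\<^sub>n N\<close>.
\<close>

lemma Eul_Dtot:
  assumes "smooth N" "dp n N = (\<lambda>x p. 0)" "n \<le> m"
  shows "Eul m n (Dtot m N) = (\<lambda>x p. 0)"
proof (intro ext)
  fix x :: real and p :: "nat \<Rightarrow> real"
  have "(\<Sum>k=0..l. (-1) ^ k * (Dtot m ^^ k) (dp k (Dtot m N)) x p) =
      (-1) ^ l * (Dtot m ^^ Suc l) (dp l N) x p" if "l \<le> m" for l
    using that
  proof (induction l)
    case 0
    show ?case by (simp add: dp_0_Dtot assms(1))
  next
    case (Suc l)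
    have "dp (Suc l) (Dtot m N) = (\<lambda>x p. Dtot m (dp (Suc l) N) x p + dp l N x p)"
      using Suc.prems by (intro dp_Suc_Dtot assms(1)) simp
    then have "(Dtot m ^^ Suc l) (dp (Suc l) (Dtot m N)) x p =
        (Dtot m ^^ Suc (Suc l)) (dp (Suc l) N) x p + (Dtot m ^^ Suc l) (dp l N) x p"
      by (simp only: Dtot_pow_add smooth_Dtot smooth_dp assms(1)) (simp only: funpow_Suc_right o_apply)
    with Suc show ?case
      by (simp del: funpow.simps add: algebra_simps)
  qed
  from this[of n] assms(3) show "Eul m n (Dtot m N) x p = 0"
    by (simp del: funpow.simps add: Eul_def assms(2) Dtot_pow_const)
qed

text \<open>
  Neither a longer sum nor a later truncation changes the Euler expression of a Lagrangian of order \<open>l\<close>,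
  because \<open>D\<^sup>k \<partial>\<^sub>k G\<close> vanishes for \<open>k > l\<close> and has order at most \<open>2 l\<close> for \<open>k \<le> l\<close>.
\<close>

lemma Eul_of_lower_order:
  assumes "depends_upto l G" "l \<le> n" "2 * l \<le> m"
  shows "Eul m n G = Eul (2 * l) l G"
proof (intro ext)
  fix x :: real and p :: "nat \<Rightarrow> real"
  have "(\<Sum>k=0..n. (-1) ^ k * (Dtot m ^^ k) (dp k G) x p) =
      (\<Sum>k=0..l. (-1) ^ k * (Dtot m ^^ k) (dp k G) x p)"
    using assms(2) by (intro sum.mono_neutral_right) (auto simp: dp_beyond[OF assms(1)] Dtot_pow_const)
  also have "\<dots> = (\<Sum>k=0..l. (-1) ^ k * (Dtot (2 * l) ^^ k) (dp k G) x p)"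
  proof (intro sum.cong refl)
    fix k assume "k \<in> {0..l}"
    then have "(Dtot m ^^ k) (dp k G) = (Dtot (2 * l) ^^ k) (dp k G)"
      using assms(3) by (intro Dtot_pow_trunc[OF depends_upto_dp[OF assms(1)]]) auto
    then show "(-1) ^ k * (Dtot m ^^ k) (dp k G) x p = (-1) ^ k * (Dtot (2 * l) ^^ k) (dp k G) x p"
      by simp
  qed
  finally show "Eul m n G x p = Eul (2 * l) l G x p"
    by (simp add: Eul_def)
qed

text \<open>
  The highest variable \<open>p\<^sub>2\<^sub>l\<close> enters only through the last of the \<open>l\<close> total derivatives applied to
  \<open>\<partial>\<^sub>l G\<close>, and linearly, with the coefficient computed in \<open>dp_top_Dtot_pow\<close>.
\<close>

lemma Eul_leading_term:
  assumes "smooth G" "depends_upto l G" "l \<ge> 1"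
  shows "Eul (2 * l) l G x p = Eul (2 * l - 1) l G x p + (-1) ^ l * (p (2 * l) * dp l (dp l G) x p)"
proof -
  obtain h where l: "l = Suc h"
    using assms(3) by (cases l) auto
  define m where "m = Suc (2 * h)"
  have m: "2 * l = Suc m" "2 * l - 1 = m" "l + h = m"
    by (simp_all add: l m_def)
  let ?K = "(Dtot m ^^ h) (dp l G)"
  have same: "(Dtot (Suc m) ^^ k) (dp k G) = (Dtot m ^^ k) (dp k G)" if "k \<le> h" for k
    using that by (intro Dtot_pow_trunc[OF depends_upto_dp[OF assms(2)]]) (auto simp: l m_def)
  have "(Dtot (Suc m) ^^ l) (dp l G) = Dtot (Suc m) ?K"
    unfolding l funpow.simps o_apply
    by (rule arg_cong[where f = "Dtot (Suc m)"], rule Dtot_pow_trunc[OF depends_upto_dp[OF assms(2)]])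
      (auto simp: l m_def)
  then have last: "(Dtot (Suc m) ^^ l) (dp l G) x p = (Dtot m ^^ l) (dp l G) x p + p (Suc m) * dp m ?K x p"
    by (simp only: Dtot_Suc) (simp only: l funpow.simps o_apply)
  have top: "dp m ?K = dp l (dp l G)"
    using dp_top_Dtot_pow[OF smooth_dp[OF assms(1), of l] depends_upto_dp[OF assms(2)], of h m]
    by (simp only: m order_refl)
  have split: "Eul k l G x p = (\<Sum>i=0..h. (-1) ^ i * (Dtot k ^^ i) (dp i G) x p) +
      (-1) ^ l * (Dtot k ^^ l) (dp l G) x p" for k
    unfolding Eul_def l sum.atLeast0_atMost_Suc ..
  have low: "(\<Sum>i=0..h. (-1) ^ i * (Dtot (Suc m) ^^ i) (dp i G) x p) = (\<Sum>i=0..h. (-1) ^ i * (Dtot m ^^ i) (dp i G) x p)"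
    by (intro sum.cong refl) (simp add: same)
  show ?thesis
    unfolding m diff_Suc_1 split low last top by (simp only: distrib_left ac_simps)
qed

text \<open>
  Truncation at \<open>2 n - 2\<close> loses the terms that contain \<open>p\<^sub>2\<^sub>n\<close> or \<open>p\<^sub>2\<^sub>n\<^sub>-\<^sub>1\<close>. They come from the last two
  total derivatives in \<open>D\<^sup>n \<partial>\<^sub>n G\<close> and from the last one in \<open>D\<^sup>n\<^sup>-\<^sup>1 \<partial>\<^sub>n\<^sub>-\<^sub>1 G\<close>. The mixed derivative
  \<open>\<partial>\<^sub>n\<^sub>-\<^sub>1 \<partial>\<^sub>n G\<close> occurs in both, with opposite signs, and cancels. For \<open>n \<ge> 3\<close> one has \<open>n + 1 \<le> 2 n - 2\<close>, so
  that all truncations agree on \<open>\<partial>\<^sub>n \<partial>\<^sub>n G\<close>, which has order \<open>n\<close>.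
\<close>

lemma Eul_two_leading_terms:
  assumes "smooth G" "depends_upto n G" "n \<ge> 3"
  shows "Eul (2 * n) n G x p = Eul (2 * n - 2) n G x p +
    (-1) ^ n * (p (2 * n) * dp n (dp n G) x p + real n * p (2 * n - 1) * Dtot (n + 1) (dp n (dp n G)) x p)"
proof -
  define h where "h = n - 2"
  have n: "n = Suc (Suc h)" and "h \<ge> 1"
    using assms(3) by (auto simp: h_def)
  define m where "m = 2 * n - 2"
  define M where "M = 2 * n"
  have m: "n + h = m" "Suc h + h < m" "Suc (Suc h + h) = m" "M = Suc (Suc m)" "M - 2 = m" "M - 1 = Suc m"
    by (simp_all add: n m_def M_def)
  let ?H = "dp n G" and ?H' = "dp (Suc h) G" and ?S = "dp n (dp n G)"
  let ?K = "(Dtot m ^^ h) ?H" and ?K' = "(Dtot m ^^ h) ?H'"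
  note sm = smooth_dp smooth_Dtot smooth_Dtot_pow assms(1)
  have ord: "depends_upto n (dp k G)" for k
    by (rule depends_upto_dp[OF assms(2)])
  have ordK: "depends_upto m ((Dtot m ^^ h) (dp k G))" for k
    using depends_upto_Dtot_pow_add[OF ord, of h] by (simp add: m)
  have same: "(Dtot M ^^ k) (dp i G) = (Dtot m ^^ k) (dp i G)" if "k \<le> h" for i k
    using that m by (intro Dtot_pow_trunc[OF ord]) auto
  have Dtot_M: "Dtot M F = (\<lambda>x p. Dtot m F x p + p (Suc m) * dp m F x p)" if "depends_upto m F" for F
  proof -
    have "Dtot M F = Dtot (Suc m) F"
      by (rule Dtot_trunc[OF that]) (simp add: m)
    then show ?thesis by (simp add: Dtot_Suc)
  qed
  \<comment> \<open>Here \<open>n + 1 \<le> 2 n - 2\<close> enters.\<close>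
  have Dtot_S: "Dtot M ?S = Dtot (n + 1) ?S" "Dtot m ?S = Dtot (n + 1) ?S"
    unfolding Suc_eq_plus1[symmetric]
    by (rule Dtot_trunc[OF depends_upto_dp[OF ord]], use \<open>h \<ge> 1\<close> in \<open>simp add: m_def M_def n\<close>)+

  have top: "dp m ?K = ?S" "dp m ?K' = dp n ?H'"
    using dp_top_Dtot_pow[OF smooth_dp[OF assms(1)] ord, where k = h and m = m] by (simp_all add: m)
  have below: "dp (Suc h + h) ?K = (\<lambda>x p. real h * Dtot m ?S x p + dp (Suc h) ?H x p)"
    unfolding n by (rule dp_below_top_Dtot_pow) (use m ord[of n] in \<open>auto simp: sm n\<close>)

  have k_last: "(Dtot M ^^ Suc h) ?H' x p = (Dtot m ^^ Suc h) ?H' x p + p (Suc m) * dp n ?H' x p"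
    by (simp add: same Dtot_M ordK top)

  have "(Dtot M ^^ n) ?H = Dtot M (Dtot M ?K)"
    by (simp add: n same[unfolded n])
  also have "Dtot M ?K = (\<lambda>x p. Dtot m ?K x p + p (Suc m) * ?S x p)"
    by (simp add: Dtot_M ordK top)
  also have "Dtot M \<dots> = (\<lambda>x p. Dtot M (Dtot m ?K) x p + (p M * ?S x p + p (Suc m) * Dtot M ?S x p))"
    by (simp add: Dtot_add Dtot_coord_mult smooth_mult smooth_coord sm m)
  also have "Dtot M (Dtot m ?K) = (\<lambda>x p. Dtot m (Dtot m ?K) x p + p (Suc m) * dp m (Dtot m ?K) x p)"
    by (rule Dtot_M) (rule depends_upto_Dtot[OF ordK], auto)
  also have "dp m (Dtot m ?K) = (\<lambda>x p. Dtot m ?S x p + (real h * Dtot m ?S x p + dp (Suc h) ?H x p))"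
    using dp_Suc_Dtot[of ?K "Suc h + h" m] by (simp add: m sm below top del: add_Suc)
  finally have k_n: "(Dtot M ^^ n) ?H x p = (Dtot m ^^ n) ?H x p + p M * ?S x p +
      p (Suc m) * (real n * Dtot (n + 1) ?S x p + dp (Suc h) ?H x p)"
    by (simp add: Dtot_S algebra_simps) (simp add: n algebra_simps)

  have split: "Eul k n G x p = (\<Sum>i=0..h. (-1) ^ i * (Dtot k ^^ i) (dp i G) x p) +
      (-1) ^ Suc h * (Dtot k ^^ Suc h) ?H' x p + (-1) ^ n * (Dtot k ^^ n) ?H x p" for k
    unfolding Eul_def n sum.atLeast0_atMost_Suc ..
  have low: "(\<Sum>i=0..h. (-1) ^ i * (Dtot M ^^ i) (dp i G) x p) = (\<Sum>i=0..h. (-1) ^ i * (Dtot m ^^ i) (dp i G) x p)"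
    by (intro sum.cong refl) (simp add: same)
  show ?thesis
    unfolding M_def[symmetric] m(5,6) split low k_last k_n dp_dp_commute[OF assms(1), of n "Suc h"]
    by (simp add: n algebra_simps del: funpow.simps)
qed

section \<open>Euler expression of the explicit Lagrangians\<close>

lemma dp_dp_antider2: "smooth F \<Longrightarrow> dp k (dp k (antider2 k F)) = F"
  by (simp add: antider2_eq dp_antider_same smooth_antider)

lemma smooth_antider2: "smooth F \<Longrightarrow> smooth (antider2 k F)"
  by (simp add: antider2_eq smooth_antider)

lemma depends_upto_antider2: "depends_upto k F \<Longrightarrow> j \<le> k \<Longrightarrow> depends_upto k (antider2 j F)"
  by (simp add: antider2_eq depends_upto_antider)

text \<open>
  Each summand of the Lagrangian is treated separately. The double integrals are made so that their
  leading coefficients are \<open>e\<^sup>-\<^sup>R\<close> and \<open>f\<^sub>l\<close>; the total derivative contributes nothing. The term with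
  \<open>D\<^sub>n\<^sub>+\<^sub>1 R\<close> in \<open>f_formula\<close> comes from \<open>D\<^sub>n\<^sub>+\<^sub>1 e\<^sup>-\<^sup>R = - e\<^sup>-\<^sup>R D\<^sub>n\<^sub>+\<^sub>1 R\<close> after division by \<open>e\<^sup>-\<^sup>R\<close>.
\<close>

lemma Eul_L_formula:
  assumes "n \<ge> 3" "smooth_upto n R" "\<And>k. k < n \<Longrightarrow> smooth_upto k (f k)" "smooth_upto (n - 1) N"
  shows "Eul (2 * n) n (L_formula n R f N) x p = exp_neg R x p * (p (2 * n) - f_formula n R f x p)"
proof -
  have R: "smooth R" "depends_upto n R" and f: "\<And>k. k < n \<Longrightarrow> smooth (f k)" "\<And>k. k < n \<Longrightarrow> depends_upto k (f k)"
    and N: "smooth N" "depends_upto (n - 1) N"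
    using assms(2-4) by (auto simp: smooth_upto_iff)
  let ?E = "Eul (2 * n) n"
  let ?G = "antider2 n (exp_neg R)"
  have G: "smooth ?G" "depends_upto n ?G"
    using R by (auto intro: smooth_antider2 smooth_exp_neg depends_upto_antider2 depends_upto_exp_neg)
  have EG: "(-1) ^ n * ?E ?G x p = (-1) ^ n * Eul (2 * n - 2) n ?G x p + exp_neg R x p * p (2 * n)
      - exp_neg R x p * (real n * Dtot (n + 1) R x p * p (2 * n - 1))"
    unfolding Eul_two_leading_terms[OF G assms(1), of x p] distrib_left left_minus_one_mult_self
    using R(1) by (simp add: dp_dp_antider2 smooth_exp_neg Dtot_exp_neg)
  have El: "(-1) ^ l * ?E (antider2 l (f l)) x p =
      f l x p * p (2 * l) + (-1) ^ l * Eul (2 * l - 1) l (antider2 l (f l)) x p" if "l \<in> {1..n - 1}" for l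
  proof -
    have l: "l < n" "l \<ge> 1" using that by auto
    have A: "smooth (antider2 l (f l))" "depends_upto l (antider2 l (f l))"
      using f l by (auto intro: smooth_antider2 depends_upto_antider2)
    have "?E (antider2 l (f l)) = Eul (2 * l) l (antider2 l (f l))"
      using l by (intro Eul_of_lower_order A) auto
    then show ?thesis
      using f(1)[OF l(1)] by (simp add: Eul_leading_term[OF A l(2)] distrib_left dp_dp_antider2)
  qed
  have E0: "?E (antider 0 (f 0)) x p = f 0 x p"
  proof -
    have "?E (antider 0 (f 0)) = Eul (2 * 0) 0 (antider 0 (f 0))"
      using assms(1) f(2)[of 0] by (intro Eul_of_lower_order depends_upto_antider) auto
    then show ?thesis
      using assms(1) f(1)[of 0] by (simp add: Eul_def dp_antider_same)
  qed
  have ED: "?E (Dtot n N) x p = 0"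
  proof -
    have "Dtot n N = Dtot (2 * n) N"
      using Dtot_trunc[OF N(2), of n] Dtot_trunc[OF N(2), of "2 * n"] assms(1) by simp
    moreover have "dp n N = (\<lambda>x p. 0)"
      using assms(1) by (intro dp_beyond[OF N(2)]) simp
    ultimately show ?thesis
      using Eul_Dtot[OF N(1), of n "2 * n"] by simp
  qed
  have sm: "smooth (\<lambda>x p. (-1) ^ l * antider2 l (f l) x p)" "smooth (antider2 l (f l))" if "l \<in> {1..n - 1}" for l
  proof -
    have "l < n" using that by auto
    then show "smooth (antider2 l (f l))" by (intro smooth_antider2 f)
    then show "smooth (\<lambda>x p. (-1) ^ l * antider2 l (f l) x p)" by (intro smooth_mult smooth_const)
  qed
  have sm0: "smooth (antider 0 (f 0))"
    using assms(1) by (intro smooth_antider f) simp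
  have smG: "smooth (\<lambda>x p. (-1) ^ n * ?G x p)"
    by (intro smooth_mult smooth_const G)
  have smS: "smooth (\<lambda>x p. \<Sum>l = 1..n - 1. (-1) ^ l * antider2 l (f l) x p)"
    by (intro smooth_sum sm)
  have ES: "?E (\<lambda>x p. \<Sum>l = 1..n - 1. (-1) ^ l * antider2 l (f l) x p) x p =
      (\<Sum>l = 1..n - 1. (-1) ^ l * ?E (antider2 l (f l)) x p)"
    by (subst Eul_sum[OF finite_atLeastAtMost sm(1)], assumption)
      (intro sum.cong refl, simp only: Eul_cmult[OF sm(2)])
  have cancel: "exp_neg R x p * (exp (R x p) * y) = y" for y
    by (simp add: exp_neg_def exp_minus)
  have "?E (L_formula n R f N) x p = (-1) ^ n * ?E ?G x p +
      (\<Sum>l = 1..n - 1. (-1) ^ l * ?E (antider2 l (f l)) x p) + ?E (antider 0 (f 0)) x p + ?E (Dtot n N) x p"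
    unfolding L_formula_def
    by (simp only: Eul_add Eul_cmult[OF G(1)] ES smooth_add smG smS sm0 smooth_Dtot[OF N(1)])
  also have "(\<Sum>l = 1..n - 1. (-1) ^ l * ?E (antider2 l (f l)) x p) =
      (\<Sum>l = 1..n - 1. f l x p * p (2 * l) + (-1) ^ l * Eul (2 * l - 1) l (antider2 l (f l)) x p)"
    by (rule sum.cong[OF refl El])
  finally have "?E (L_formula n R f N) x p = exp_neg R x p * p (2 * n)
      - exp_neg R x p * (real n * Dtot (n + 1) R x p * p (2 * n - 1))
      + ((-1) ^ n * Eul (2 * n - 2) n ?G x p +
        (\<Sum>l = 1..n - 1. f l x p * p (2 * l) + (-1) ^ l * Eul (2 * l - 1) l (antider2 l (f l)) x p) + f 0 x p)"
    unfolding EG E0 ED by linarith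
  also have "\<dots> = exp_neg R x p * (p (2 * n) - f_formula n R f x p)"
    unfolding f_formula_def right_diff_distrib cancel by linarith
  finally show ?thesis .
qed

lemma smooth_upto_f_formula:
  assumes "n \<ge> 3" "smooth_upto n R" "\<And>k. k < n \<Longrightarrow> smooth_upto k (f k)"
  shows "smooth_upto (2 * n - 1) (f_formula n R f)"
proof -
  have R: "smooth R" "depends_upto n R" and f: "\<And>k. k < n \<Longrightarrow> smooth (f k)" "\<And>k. k < n \<Longrightarrow> depends_upto k (f k)"
    using assms(2,3) by (auto simp: smooth_upto_iff)
  have E: "depends_upto (2 * n - 1) (Eul (2 * n - 2) n (antider2 n (exp_neg R)))"
    using assms(1)
    by (intro depends_upto_mono[OF depends_upto_Eul[of n _ "2 * n - 2"]] depends_upto_antider2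
        depends_upto_exp_neg R) auto
  have El: "depends_upto (2 * n - 1) (Eul (2 * l - 1) l (antider2 l (f l)))"
    "depends_upto (2 * n - 1) (f l)" "smooth (f l)" if "l \<in> {1..n - 1}" for l
  proof -
    have l: "l < n" "1 \<le> l" using that by auto
    show "depends_upto (2 * n - 1) (Eul (2 * l - 1) l (antider2 l (f l)))"
      using l by (intro depends_upto_mono[OF depends_upto_Eul[of l _ "2 * l - 1"]] depends_upto_antider2 f) auto
    show "depends_upto (2 * n - 1) (f l)" "smooth (f l)"
      using l by (auto intro: depends_upto_mono[OF f(2)] f(1))
  qed
  have D: "depends_upto (2 * n - 1) (Dtot (n + 1) R)"
    using assms(1) by (intro depends_upto_Dtot[OF R(2)]) auto
  have "smooth (f_formula n R f)"
    unfolding f_formula_def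
    using assms(1)
    by (intro smooth_diff smooth_add smooth_mult smooth_const smooth_coord smooth_Dtot smooth_exp smooth_sum
        smooth_Eul smooth_antider2 smooth_exp_neg R El(3) f(1)) auto
  moreover have "depends_upto (2 * n - 1) (f_formula n R f)"
    unfolding f_formula_def
    using assms(1)
    by (intro depends_upto_diff depends_upto_add depends_upto_mult depends_upto_const depends_upto_coord
        depends_upto_comp[where h = exp] depends_upto_sum D E El(1,2)
        depends_upto_mono[OF R(2)] depends_upto_mono[OF f(2)[of 0]]) auto
  ultimately show ?thesis by (simp add: smooth_upto_iff)
qed

lemma smooth_upto_L_formula:
  assumes "n \<ge> 3" "smooth_upto n R" "\<And>k. k < n \<Longrightarrow> smooth_upto k (f k)" "smooth_upto (n - 1) N"
  shows "smooth_upto n (L_formula n R f N)"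
proof -
  have R: "smooth R" "depends_upto n R" and f: "\<And>k. k < n \<Longrightarrow> smooth (f k)" "\<And>k. k < n \<Longrightarrow> depends_upto k (f k)"
    and N: "smooth N" "depends_upto (n - 1) N"
    using assms(2-4) by (auto simp: smooth_upto_iff)
  have fl: "smooth (f l)" "depends_upto n (f l)" if "l \<in> {1..n - 1}" for l
  proof -
    have "l < n" using that by auto
    then show "smooth (f l)" "depends_upto n (f l)"
      by (auto intro: depends_upto_mono[OF f(2)] f(1))
  qed
  have "smooth (L_formula n R f N)"
    unfolding L_formula_def
    using assms(1)
    by (intro smooth_add smooth_mult smooth_const smooth_sum smooth_Dtot N
        smooth_antider2 smooth_antider smooth_exp_neg R fl(1) f(1)) auto
  moreover have "depends_upto n (L_formula n R f N)"
    unfolding L_formula_def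
    using assms(1)
    by (intro depends_upto_add depends_upto_mult depends_upto_const depends_upto_sum
        depends_upto_antider2 depends_upto_antider depends_upto_exp_neg R fl(2) depends_upto_Dtot[OF N(2)]
        depends_upto_mono[OF f(2)[of 0]]) auto
  ultimately show ?thesis by (simp add: smooth_upto_iff)
qed

section \<open>Decomposition of a Lagrangian\<close>

text \<open>
  A function of \<open>x\<close> alone is a total derivative; this absorbs the constant of integration that is left
  when the order has been reduced to zero.
\<close>

lemma ex_dx_primitive:
  assumes "smooth g" "\<And>x p q. g x p = g x q"
  shows "\<exists>N. smooth N \<and> depends_upto 0 N \<and> dx N = g \<and> dp 0 N = (\<lambda>x p. 0)"
proof -
  define h where "h = (\<lambda>t. g t (\<lambda>_. 0))"
  define N :: jetfun where "N = (\<lambda>x p. LBINT t=0..ereal x. h t)"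
  have g: "g = (\<lambda>x p. h x)"
    unfolding h_def by (intro ext assms(2))
  have "continuous_on UNIV h"
    unfolding h_def by (rule continuous_on_jetfun[OF smooth_imp_Cr[OF assms(1)]]) (rule continuous_on_id continuous_on_const)+
  then have N_dx: "((\<lambda>t. N t p) has_real_derivative g x p) (at x)" for x p
    unfolding N_def g by (rule integral_from_0_deriv)
  have N_dp: "((\<lambda>t. N x (p(k := t))) has_real_derivative 0) (at (p k))" for k x p
    unfolding N_def by (rule DERIV_const)
  have "continuous_on UNIV (\<lambda>x. N x (\<lambda>_. 0))"
    using N_dx by (intro continuous_at_imp_continuous_on ballI DERIV_isCont)
  then have "continuous_on UNIV (\<lambda>z::real \<times> (nat \<Rightarrow> real). N (fst z) (\<lambda>_. 0))"
    by (rule continuous_on_compose2) (auto intro: continuous_on_fst continuous_on_id)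
  then have "Cr 0 N"
    by (simp add: N_def split_def)
  then have "Cr (Suc r) N" for r
    using N_dx N_dp by (rule Cr_SucI) (intro smooth_imp_Cr assms(1) smooth_const)+
  then have "smooth N"
    unfolding smooth_def using Cr_Suc_imp by blast
  moreover have "depends_upto 0 N"
    by (simp add: N_def depends_upto_def)
  moreover have "dx N = g" "dp 0 N = (\<lambda>x p. 0)"
    by (rule dx_eqI, rule N_dx) (rule dp_eqI, rule N_dp)
  ultimately show ?thesis by blast
qed

text \<open>
  Induction on the order: subtracting the double integral of \<open>\<partial>\<^sub>l \<partial>\<^sub>l L\<close> leaves a function
  \<open>a p\<^sub>l + b\<close> with \<open>a\<close>, \<open>b\<close> of order \<open>l - 1\<close>, and \<open>a p\<^sub>l\<close> is the leading part of the total derivative of the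
  antiderivative of \<open>a\<close> in \<open>p\<^sub>l\<^sub>-\<^sub>1\<close>. The condition \<open>dp l N = 0\<close> says that \<open>N\<close> has order \<open>l - 1\<close> in a form
  that also makes sense for \<open>l = 0\<close>, where \<open>N\<close> is a function of \<open>x\<close> alone.
\<close>

lemma Lagrangian_decomposition:
  assumes "smooth_upto l L"
  shows "\<exists>f N. (\<forall>k\<le>l. smooth_upto k (f k)) \<and> smooth_upto l N \<and> dp l N = (\<lambda>x p. 0) \<and>
    (l > 0 \<longrightarrow> f l = (\<lambda>x p. (-1) ^ l * dp l (dp l L) x p)) \<and>
    L = (\<lambda>x p. (\<Sum>i=1..l. (-1) ^ i * antider2 i (f i) x p) + antider 0 (f 0) x p + Dtot l N x p)"
  using assms
proof (induction l arbitrary: L)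
  case 0
  then have L: "smooth L" "depends_upto 0 L" by (simp_all add: smooth_upto_iff)
  define g where "g = (\<lambda>x p. L x p - antider 0 (dp 0 L) x p)"
  have g: "smooth g" "depends_upto 0 g" "dp 0 g = (\<lambda>x p. 0)"
    using L unfolding g_def
    by (auto simp: dp_diff smooth_antider smooth_dp dp_antider_same
        intro: smooth_diff smooth_antider smooth_dp depends_upto_diff depends_upto_antider depends_upto_dp)
  have "g x p = g x q" for x p q
  proof -
    have "g x p = g x (p(0 := q 0))"
      using dp_zero_imp_const[OF g(1,3), of x p "p 0"] by simp
    also have "\<dots> = g x q"
      by (rule depends_uptoD[OF g(2)]) simp
    finally show ?thesis .
  qed
  from ex_dx_primitive[OF g(1) this]
  obtain N where N: "smooth N" "depends_upto 0 N" "dx N = g" "dp 0 N = (\<lambda>x p. 0)" by blast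
  show ?case
    using L N by (intro exI[of _ "\<lambda>k. dp 0 L"] exI[of _ N])
      (auto simp: smooth_upto_iff smooth_dp depends_upto_dp Dtot_def g_def)
next
  case (Suc l)
  let ?k = "Suc l"
  have L: "smooth L" "depends_upto ?k L" using Suc.prems by (simp_all add: smooth_upto_iff)
  define F where "F = (\<lambda>x p. (-1) ^ ?k * dp ?k (dp ?k L) x p)"
  have F: "smooth F" "depends_upto ?k F"
    unfolding F_def using L by (auto intro!: smooth_mult smooth_const smooth_dp
        depends_upto_mult depends_upto_const depends_upto_dp simp del: power_Suc)
  define L1 where "L1 = (\<lambda>x p. L x p - (-1) ^ ?k * antider2 ?k F x p)"
  have sA: "smooth (\<lambda>x p. (-1) ^ ?k * antider2 ?k F x p)"
    by (intro smooth_mult smooth_const smooth_antider2 F)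
  have L1: "smooth L1" "depends_upto ?k L1"
    unfolding L1_def by (intro smooth_diff sA L depends_upto_diff depends_upto_mult depends_upto_const
        depends_upto_antider2 F order_refl)+
  define a where "a = dp ?k L1"
  have a: "smooth a" "depends_upto ?k a"
    unfolding a_def by (intro smooth_dp depends_upto_dp L1)+
  have "dp ?k a = (\<lambda>x p. dp ?k (dp ?k L) x p - (-1) ^ ?k * F x p)"
    unfolding a_def L1_def
    by (simp only: dp_diff L sA smooth_dp dp_cmult smooth_antider2 F dp_dp_antider2 smooth_mult smooth_const)
  also have "\<dots> = (\<lambda>x p. 0)"
    by (simp add: F_def power_mult_distrib[symmetric] flip: mult.assoc)
  finally have "depends_upto l a"
    by (rule depends_upto_lower[OF a])
  define M where "M = antider l a"
  have M: "smooth M" "depends_upto l M" "dp l M = a"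
    unfolding M_def using a \<open>depends_upto l a\<close>
    by (auto intro: smooth_antider depends_upto_antider simp: dp_antider_same)
  have M': "dp ?k M = (\<lambda>x p. 0)"
    by (rule dp_beyond[OF M(2)]) simp
  define L2 where "L2 = (\<lambda>x p. L1 x p - Dtot ?k M x p)"
  have L2: "smooth L2" "depends_upto ?k L2"
    unfolding L2_def using M L1
    by (auto intro!: smooth_diff smooth_Dtot depends_upto_diff depends_upto_Dtot[OF M(2)])
  have "dp ?k L2 = (\<lambda>x p. 0)"
    unfolding L2_def by (simp add: dp_diff L1 smooth_Dtot M dp_Suc_Dtot M' Dtot_const a_def)
  then have "smooth_upto l L2"
    using depends_upto_lower[OF L2] L2(1) by (simp add: smooth_upto_iff)
  from Suc.IH[OF this] obtain f N
    where f: "\<forall>k\<le>l. smooth_upto k (f k)" and N: "smooth_upto l N" "dp l N = (\<lambda>x p. 0)"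
      and eq: "L2 = (\<lambda>x p. (\<Sum>i=1..l. (-1) ^ i * antider2 i (f i) x p) + antider 0 (f 0) x p + Dtot l N x p)"
    by blast
  have sN: "smooth N" "depends_upto l N"
    using N by (auto simp: smooth_upto_iff)
  define N' where "N' = (\<lambda>x p. N x p + M x p)"
  have N': "smooth N'" "depends_upto l N'"
    unfolding N'_def by (intro smooth_add depends_upto_add sN M)+
  have "Dtot ?k N' = (\<lambda>x p. Dtot l N x p + Dtot ?k M x p)"
    unfolding N'_def by (simp add: Dtot_add sN M(1) Dtot_Suc[of l N] N(2))
  then have "L x p = (\<Sum>i=1..?k. (-1) ^ i * antider2 i ((f(?k := F)) i) x p)
      + antider 0 ((f(?k := F)) 0) x p + Dtot ?k N' x p" for x p
    using fun_cong[OF fun_cong[OF eq], of x p] by (simp add: L2_def L1_def)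
  then have "L = (\<lambda>x p. (\<Sum>i=1..?k. (-1) ^ i * antider2 i ((f(?k := F)) i) x p)
      + antider 0 ((f(?k := F)) 0) x p + Dtot ?k N' x p)"
    by (intro ext)
  moreover have "\<forall>i\<le>?k. smooth_upto i ((f(?k := F)) i)"
    using f F by (auto simp: smooth_upto_iff)
  moreover have "smooth_upto ?k N'" "dp ?k N' = (\<lambda>x p. 0)"
    using N' by (auto simp: smooth_upto_iff intro: depends_upto_mono dp_beyond)
  ultimately show ?case
    unfolding F_def by (intro exI[of _ "f(?k := F)"] exI[of _ N']) (simp add: F_def)
qed

text \<open>
  Both sides of the multiplier equation are affine in \<open>p\<^sub>2\<^sub>n\<close>; this compares the slopes, by evaluation
  at \<open>p\<^sub>2\<^sub>n = 0\<close> and \<open>p\<^sub>2\<^sub>n = 1\<close>.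
\<close>

lemma multiplier_eq_second_derivative:
  assumes "n \<ge> 1" "multiplier_solution n g L \<rho>"
  shows "\<rho> = (\<lambda>x p. (-1) ^ n * dp n (dp n L) x p)"
proof (intro ext)
  fix x :: real and p :: "nat \<Rightarrow> real"
  have g: "depends_upto (2 * n - 1) g" and L: "smooth L" "depends_upto n L" and \<rho>: "depends_upto n \<rho>"
    and eq: "\<And>x p. \<rho> x p * (p (2 * n) - g x p) = Eul (2 * n) n L x p"
    using assms(2) by (auto simp: multiplier_solution_def smooth_upto_iff)
  let ?S = "dp n (dp n L)" and ?E = "Eul (2 * n - 1) n L"
  have E: "depends_upto (2 * n - 1) ?E"
    using assms(1) by (intro depends_upto_Eul[OF L(2)]) auto
  have ord: "depends_upto (2 * n - 1) \<rho>" "depends_upto (2 * n - 1) ?S"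
    using assms(1) by (auto intro: depends_upto_mono[OF \<rho>] depends_upto_mono[OF depends_upto_dp[OF depends_upto_dp[OF L(2)]]])
  have inv: "F x (p(2 * n := u)) = F x p" if "depends_upto (2 * n - 1) F" for F u
    using assms(1) by (intro depends_uptoD[OF that]) auto
  have "\<rho> x p * (u - g x p) = ?E x p + (-1) ^ n * (u * ?S x p)" for u
    using eq[of x "p(2 * n := u)"] Eul_leading_term[OF L assms(1), of x "p(2 * n := u)"]
    unfolding inv[OF ord(1)] inv[OF ord(2)] inv[OF g] inv[OF E] by simp
  from this[of 0] this[of 1] show "\<rho> x p = (-1) ^ n * ?S x p"
    by (simp add: algebra_simps)
qed

section \<open>The characterization\<close>

theorem theorem1p3:
  fixes n :: nat
  assumes "n \<ge> 3"
  shows "(\<forall>f2n1 L \<rho>. multiplier_solution n f2n1 L \<rho> \<longrightarrow>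
            (\<exists>R f N. smooth_upto n R \<and> (\<forall>k<n. smooth_upto k (f k)) \<and> smooth_upto (n - 1) N \<and>
               f2n1 = f_formula n R f \<and> \<rho> = exp_neg R \<and> L = L_formula n R f N)) \<and>
         (\<forall>R f N. smooth_upto n R \<and> (\<forall>k<n. smooth_upto k (f k)) \<and> smooth_upto (n - 1) N \<longrightarrow>
            multiplier_solution n (f_formula n R f) (L_formula n R f N) (exp_neg R))"
proof (intro conjI allI impI)
  fix g L \<rho>
  assume sol: "multiplier_solution n g L \<rho>"
  then have L: "smooth_upto n L" and \<rho>: "smooth_upto n \<rho>" and pos: "\<And>x p. \<rho> x p > 0"
    and eq: "\<And>x p. \<rho> x p * (p (2 * n) - g x p) = Eul (2 * n) n L x p"
    by (auto simp: multiplier_solution_def)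
  define R where "R = (\<lambda>x p. - ln (\<rho> x p))"
  have R: "smooth_upto n R"
    using \<rho> smooth_minus[OF smooth_ln, of \<rho>] pos depends_upto_comp[of n \<rho> "\<lambda>y. - ln y"]
    unfolding R_def smooth_upto_iff by blast
  have \<rho>_eq: "\<rho> = exp_neg R"
    using pos by (simp add: R_def exp_neg_def)
  from Lagrangian_decomposition[OF L] assms obtain f N
    where f: "\<forall>k\<le>n. smooth_upto k (f k)" and N: "smooth_upto n N" "dp n N = (\<lambda>x p. 0)"
      and fn: "f n = (\<lambda>x p. (-1) ^ n * dp n (dp n L) x p)"
      and dec: "L = (\<lambda>x p. (\<Sum>i=1..n. (-1) ^ i * antider2 i (f i) x p) + antider 0 (f 0) x p + Dtot n N x p)"
    by auto
  have n: "n = Suc (n - 1)" using assms by simp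
  have "f n = exp_neg R"
    using multiplier_eq_second_derivative[OF _ sol] assms fn \<rho>_eq by simp
  moreover have "(\<Sum>i=1..n. h i) = (\<Sum>i=1..n - 1. h i) + h n" for h :: "nat \<Rightarrow> real"
    using assms sum.cl_ivl_Suc[of h 1 "n - 1"] unfolding n[symmetric] by simp
  ultimately have L_eq: "L = L_formula n R f N"
    by (subst dec, unfold L_formula_def) (simp only: ac_simps)
  have N': "smooth_upto (n - 1) N"
    using N depends_upto_lower[of N "n - 1"] n by (simp add: smooth_upto_iff)
  \<comment> \<open>The formula for \<open>g\<close> is forced: both functions solve the same equation with the same multiplier.\<close>
  have "g = f_formula n R f"
  proof (intro ext)
    fix x p
    have "exp_neg R x p * (p (2 * n) - g x p) = exp_neg R x p * (p (2 * n) - f_formula n R f x p)"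
      using eq[of x p] Eul_L_formula[OF assms R _ N', of f x p] f \<rho>_eq L_eq by simp
    moreover have "exp_neg R x p \<noteq> 0" by (simp add: exp_neg_def)
    ultimately show "g x p = f_formula n R f x p" by simp
  qed
  with R f N' \<rho>_eq L_eq
  show "\<exists>R f N. smooth_upto n R \<and> (\<forall>k<n. smooth_upto k (f k)) \<and> smooth_upto (n - 1) N \<and>
      g = f_formula n R f \<and> \<rho> = exp_neg R \<and> L = L_formula n R f N"
    by (intro exI[of _ R] exI[of _ f] exI[of _ N]) auto
next
  fix R f N
  assume "smooth_upto n R \<and> (\<forall>k<n. smooth_upto k (f k)) \<and> smooth_upto (n - 1) N"
  then have R: "smooth_upto n R" and f: "\<And>k. k < n \<Longrightarrow> smooth_upto k (f k)" and N: "smooth_upto (n - 1) N"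
    by auto
  have "smooth_upto n (exp_neg R)"
    using R by (simp add: smooth_upto_iff smooth_exp_neg depends_upto_exp_neg)
  moreover have "exp_neg R x p > 0" for x p
    by (simp add: exp_neg_def)
  ultimately show "multiplier_solution n (f_formula n R f) (L_formula n R f N) (exp_neg R)"
    unfolding multiplier_solution_def
    using smooth_upto_f_formula[OF assms R f] smooth_upto_L_formula[OF assms R f N] Eul_L_formula[OF assms R f N]
    by simp
qed

end
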